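(* Let $m$ be an integer such that $q=4m^2+4m+3$ is a prime power. Let $\omega$ be a primitive element of $\mathbb{F}_{q^2}$, $C_i^{(8,q^2)}=\omega^i\langle\omega^8\rangle$ (indices mod 8), $\chi_8$ the multiplicative character of $\mathbb{F}_{q^2}$ with $\chi_8(\omega)=\zeta_8=e^{2\pi i/8}$, $\zeta_4=i$, and $\eta$ the quadratic character of $\mathbb{F}_q$. Let $\epsilon,\delta\in\{1,-1\}$ be such that $G_{q^2}(\chi_8)=G_q(\eta)(\epsilon(2m+1)+\delta\sqrt{-2})$ (such signs exist). Let $h'\in\{0,1,2,3\}$, put $h=2h'+(1-\epsilon\delta)/2$, and let $\ell$ be an integer not divisible by $q+1$ such that \[ \chi_8(\omega^\ell)=\zeta_8^{2-5\epsilon\delta-6h'},\qquad \chi_8(\omega^{\ell q}-\omega^\ell)=-\zeta_4^{\delta}. \] Let $H=\{h+i \bmod 8: i=0,1,2,3\}$ and $D_{\ell,H}=\{x\in\mathbb{F}_q: 1+x\omega^\ell\in\bigcup_{i\in H}C_i^{(8,q^2)}\}$. Then $|D_{\ell,H}|=2m^2+m+2$ and \[ \{|D_{\ell,H}\cap((C_0^{(2,q)}\cup\{0\})+s)|: s\in\mathbb{F}_q\}=\{m^2+1,m^2+2,m^2+m+1,m^2+m+2\}, \] where $C_0^{(2,q)}$ is the set of nonzero squares of $\mathbb{F}_q$.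
   Context: For a prime power $Q=p^f$, the canonical additive character of $\mathbb{F}_Q$ is $\psi_{\mathbb{F}_Q}(x)=\exp(2\pi i\,\mathrm{Tr}_{Q/p}(x)/p)$, and for a multiplicative character $\chi$ of $\mathbb{F}_Q$ the Gauss sum is $G_Q(\chi)=\sum_{x\in\mathbb{F}_Q^*}\chi(x)\psi_{\mathbb{F}_Q}(x)$.
   Formalization: The set of intersection sizes is claimed only for m ≠ −1: for m = −1 (q = 3) one has D = F_3, so every intersection has size 2 and the stated equality fails. The size of D is proved for all m. The existence of the signs ε, δ is not proved; they are given with the Gauss sum equation. *)

theory Defs
  imports "HOL-Analysis.Analysis" "HOL-Number_Theory.Number_Theory"
begin

text \<open>
  The field with \<open>q\<^sup>2\<close> elements is a type of class \<open>{field, finite}\<close>; its subfield with \<open>q\<close>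
  elements is a subset of that type. Traces, additive characters and Gauss sums are
  parameterised by a subfield \<open>K\<close>, so that \<open>K = UNIV\<close> gives the notions for the whole field.
\<close>

definition is_subfield :: "'a::field set \<Rightarrow> bool" where
  "is_subfield K \<longleftrightarrow> 0 \<in> K \<and> 1 \<in> K \<and>
     (\<forall>x\<in>K. \<forall>y\<in>K. x + y \<in> K \<and> x * y \<in> K) \<and> (\<forall>x\<in>K. - x \<in> K \<and> inverse x \<in> K)"

definition primitive_element :: "'a::field \<Rightarrow> bool" where
  "primitive_element w \<longleftrightarrow> range (\<lambda>k::nat. w ^ k) = UNIV - {0}"

definition prime_degree :: "'a::field set \<Rightarrow> nat" where
  "prime_degree K = (THE f. card K = CHAR('a) ^ f)"

definition abs_trace :: "'a::field set \<Rightarrow> 'a \<Rightarrow> 'a" where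
  "abs_trace K x = (\<Sum>i<prime_degree K. x ^ (CHAR('a) ^ i))"

text \<open>The trace lies in the prime field, whose elements are lifted to \<open>{0..<p}\<close>.\<close>

definition prime_field_lift :: "'a::field \<Rightarrow> nat" where
  "prime_field_lift y = (THE n. n < CHAR('a) \<and> of_nat n = y)"

definition canonical_add_char :: "'a::field set \<Rightarrow> 'a \<Rightarrow> complex" where
  "canonical_add_char K x =
     exp (2 * of_real pi * \<i> * of_nat (prime_field_lift (abs_trace K x)) / of_nat CHAR('a))"

text \<open>The value of a multiplicative character at \<open>0\<close> is left unconstrained; it is never used.\<close>

definition mult_char :: "'a::field set \<Rightarrow> ('a \<Rightarrow> complex) \<Rightarrow> bool" where
  "mult_char K chi \<longleftrightarrow> (\<forall>x\<in>K - {0}. chi x \<noteq> 0) \<and>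
     (\<forall>x\<in>K - {0}. \<forall>y\<in>K - {0}. chi (x * y) = chi x * chi y)"

definition gauss_sum :: "'a::field set \<Rightarrow> ('a \<Rightarrow> complex) \<Rightarrow> complex" where
  "gauss_sum K chi = (\<Sum>x\<in>K - {0}. chi x * canonical_add_char K x)"

definition nonzero_squares :: "'a::field set \<Rightarrow> 'a set" where
  "nonzero_squares K = {y\<^sup>2 | y. y \<in> K \<and> y \<noteq> 0}"

definition quad_char :: "'a::field set \<Rightarrow> 'a \<Rightarrow> complex" where
  "quad_char K x = (if x = 0 then 0 else if x \<in> nonzero_squares K then 1 else - 1)"

definition cyc_class :: "nat \<Rightarrow> 'a::field \<Rightarrow> int \<Rightarrow> 'a set" where
  "cyc_class N w i = {w powi i * (w ^ N) powi k | k :: int. True}"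

definition D_set :: "'a::field set \<Rightarrow> 'a \<Rightarrow> int \<Rightarrow> int set \<Rightarrow> 'a set" where
  "D_set K w l H = {x \<in> K. 1 + x * w powi l \<in> (\<Union>i\<in>H. cyc_class 8 w i)}"

end

theory Submission
  imports Defs
begin

text \<open>
  Write \<open>A = \<omega>\<^sup>l\<close>. Since \<open>q \<equiv> 3 (mod 8)\<close>, the character \<open>\<chi>\<^sub>8\<close> restricts to \<open>\<eta>\<close> on the subfield, so
  grouping \<open>G(\<chi>\<^sub>8)\<close> by relative trace gives \<open>G(\<chi>\<^sub>8) = E * G(\<eta>)\<close>, where \<open>E\<close> is the sum of \<open>\<chi>\<^sub>8\<close> over the
  elements of relative trace \<open>1\<close>. As \<open>G(\<eta>) \<noteq> 0\<close>, the hypothesis says \<open>E = \<epsilon>(2m+1) + \<delta>\<surd>-2\<close>. Every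
  affine line avoiding \<open>0\<close> is a multiple of the trace-one line, which evaluates the sum of \<open>\<chi>\<^sub>8(1+xA)\<close>
  over \<open>x\<close>, and the substitution \<open>y = 1/(x-s)\<close> does the same for the sum of \<open>\<eta>(x-s) \<chi>\<^sub>8(1+xA)\<close>; the
  latter depends only on the class of \<open>1+sA\<close> modulo \<open>8\<close>. Integer relations between powers of a primitive
  eighth root of unity survive replacing these powers by any sequence \<open>\<phi>\<close> with \<open>\<phi>(n+4) = -\<phi>(n)\<close>, so both
  sums turn into counting formulas: the size of \<open>D\<close> and the intersection numbers as functions of that
  class. All four values occur because the even powers of \<open>\<chi>\<^sub>8\<close> are trivial on the subfield, whence
  their sums over the line are known too, and together these sums give the number of \<open>s\<close> in each class
  modulo \<open>8\<close>.
\<close>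

section \<open>Finite subfields\<close>

lemma prime_CHAR_finite_field: "prime CHAR('a::{field,finite})"
  using prime_CHAR_semidom[where ?'a = 'a] finite_imp_CHAR_pos[where ?'a = 'a] by simp

lemma prime_degree_eqI:
  fixes K :: "'a::{field,finite} set"
  assumes "card K = CHAR('a) ^ f"
  shows "prime_degree K = f"
  unfolding prime_degree_def
  using assms prime_gt_1_nat[OF prime_CHAR_finite_field[where ?'a = 'a]]
  by (intro the_equality) auto

lemma is_subfield_UNIV: "is_subfield (UNIV :: 'a::field set)"
  by (simp add: is_subfield_def)

lemma bij_betw_mult_subfield_units:
  fixes K :: "'a::field set"
  assumes "is_subfield K" "c \<in> K - {0}"
  shows "bij_betw ((*) c) (K - {0}) (K - {0})"
proof (rule bij_betw_byWitness[where f' = "(*) (inverse c)"])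
qed (use assms in \<open>auto simp: is_subfield_def\<close>)

lemma subfield_power_card_minus_1:
  fixes K :: "'a::field set"
  assumes subfield: "is_subfield K" "finite K" and x_unit: "x \<in> K - {0}"
  shows "x ^ (card K - 1) = 1"
proof -
  have "(\<Prod>y\<in>K - {0}. y) = (\<Prod>y\<in>K - {0}. x * y)"
    using prod.reindex_bij_betw[OF bij_betw_mult_subfield_units[OF subfield(1) x_unit], of "\<lambda>y. y"]
    by simp
  also have "\<dots> = x ^ (card K - 1) * (\<Prod>y\<in>K - {0}. y)"
    using subfield by (simp add: prod.distrib is_subfield_def card_Diff_singleton)
  finally show ?thesis using subfield(2) by simp
qed

lemma subfield_power_card:
  fixes K :: "'a::field set"
  assumes "is_subfield K" "finite K" "x \<in> K"
  shows "x ^ card K = x"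
proof -
  have "card K > 0" using assms by (auto simp: card_gt_0_iff)
  then have "x ^ card K = x ^ (card K - 1) * x" by (simp flip: power_Suc2)
  then show ?thesis using subfield_power_card_minus_1[OF assms(1,2), of x] assms(3)
    by (cases "x = 0") simp_all
qed

lemma card_power_fixed_le:
  assumes "n \<ge> 2"
  shows "card {x::'a::idom. x ^ n = x} \<le> n"
proof -
  define P where "P = Polynomial.monom (1::'a) n - Polynomial.monom 1 1"
  have degree: "degree P = n"
    using degree_add_eq_left[of "- Polynomial.monom 1 1" "Polynomial.monom (1::'a) n"] assms
    by (simp add: P_def degree_monom_eq)
  then have "P \<noteq> 0" using assms by auto
  from card_poly_roots_bound[OF this] show ?thesis
    unfolding degree by (simp add: P_def poly_monom)
qed

lemma prime_field_eq_power_fixed: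
  "of_nat ` {..<CHAR('a)} = {x::'a::{field,finite}. x ^ CHAR('a) = x}"
proof (rule card_seteq)
  have "(of_nat n :: 'a) ^ CHAR('a) = of_nat n" for n
    by (induction n)
      (simp_all add: freshmans_dream[OF prime_CHAR_finite_field] prime_CHAR_finite_field
        prime_gt_0_nat)
  then show "of_nat ` {..<CHAR('a)} \<subseteq> {x::'a. x ^ CHAR('a) = x}"
    by auto
  have "card (of_nat ` {..<CHAR('a)} :: 'a set) = CHAR('a)"
    by (subst card_image) (auto intro!: inj_onI simp: of_nat_eq_iff_cong_CHAR cong_def)
  then show "card {x::'a. x ^ CHAR('a) = x} \<le> card (of_nat ` {..<CHAR('a)} :: 'a set)"
    using card_power_fixed_le[OF prime_ge_2_nat[OF prime_CHAR_finite_field]] by simp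
qed auto

lemma prime_field_lift_less_CHAR_of_nat:
  fixes y :: "'a::{field,finite}"
  assumes "y ^ CHAR('a) = y"
  shows "prime_field_lift y < CHAR('a) \<and> of_nat (prime_field_lift y) = y"
proof -
  have "y \<in> of_nat ` {..<CHAR('a)}"
    unfolding prime_field_eq_power_fixed using assms by simp
  then obtain n where n_lift: "n < CHAR('a)" "of_nat n = y"
    by blast
  show ?thesis
    unfolding prime_field_lift_def
  proof (rule theI[of _ n])
    show "k = n" if "k < CHAR('a) \<and> of_nat k = y" for k
      using that n_lift of_nat_eq_iff_cong_CHAR[where ?'a = 'a, of k n] by (simp add: cong_def)
  qed (use n_lift in simp)
qed

lemmas prime_field_lift_less_CHAR = prime_field_lift_less_CHAR_of_nat[THEN conjunct1]
  and of_nat_prime_field_lift = prime_field_lift_less_CHAR_of_nat[THEN conjunct2]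

locale finite_subfield =
  fixes K :: "'a::{field,finite} set"
  assumes subfield: "is_subfield K"
    and card_K: "card K = CHAR('a) ^ prime_degree K"
begin

abbreviation q :: nat where "q \<equiv> card K"

lemma zero_in_K: "0 \<in> K" and one_in_K: "1 \<in> K"
  using subfield by (auto simp: is_subfield_def)

lemma K_nonempty [simp]: "K \<noteq> {}"
  using zero_in_K by blast

lemma q_gt_1: "q > 1"
  using card_mono[of K "{0, 1}"] zero_in_K one_in_K by simp

lemma prime_degree_pos: "prime_degree K > 0"
  using q_gt_1 card_K by (cases "prime_degree K") simp_all

lemma frobenius_add: "((x::'a) + y) ^ q = x ^ q + y ^ q"
  unfolding card_K by (rule freshmans_dream'[OF prime_CHAR_finite_field refl])

lemma frobenius_uminus: "(- x::'a) ^ q = - (x ^ q)"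
  using frobenius_add[of x "- x"] by (simp add: eq_neg_iff_add_eq_0 add.commute power_0_left)

lemma frobenius_diff: "((x::'a) - y) ^ q = x ^ q - y ^ q"
  using frobenius_add[of x "- y"] by (simp add: frobenius_uminus)

lemma mem_K_iff: "x \<in> K \<longleftrightarrow> x ^ q = x"
proof -
  have "K = {x. x ^ q = x}"
    using subfield_power_card[OF subfield] card_power_fixed_le[of q] q_gt_1
    by (intro card_seteq) auto
  then show ?thesis by auto
qed

lemma K_closed:
  assumes "x \<in> K" "y \<in> K"
  shows "x + y \<in> K" "x - y \<in> K" "x * y \<in> K" "x / y \<in> K"
  using assms
  by (simp_all add: mem_K_iff frobenius_add frobenius_diff power_mult_distrib power_divide)

lemma K_uminus: "x \<in> K \<Longrightarrow> - x \<in> K"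
  by (simp add: mem_K_iff frobenius_uminus)

lemma bij_betw_add_K: "a \<in> K \<Longrightarrow> bij_betw (\<lambda>x. x + a) K K"
  by (rule bij_betw_byWitness[where f' = "\<lambda>x. x - a"]) (auto intro: K_closed)

lemma bij_betw_mult_K: "c \<in> K - {0} \<Longrightarrow> bij_betw (\<lambda>x. x * c) K K"
  by (rule bij_betw_byWitness[where f' = "\<lambda>x. x / c"]) (auto intro: K_closed)

end

section \<open>Additive characters and Gauss sums\<close>

lemma abs_trace_add:
  fixes K :: "'a::{field,finite} set"
  shows "abs_trace K (x + y) = abs_trace K x + abs_trace K y"
  by (simp add: abs_trace_def sum.distrib freshmans_dream'[OF prime_CHAR_finite_field])

context finite_subfield
begin

lemma abs_trace_power_CHAR:
  assumes "x \<in> K"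
  shows "abs_trace K x ^ CHAR('a) = abs_trace K x"
proof -
  let ?f = "prime_degree K"
  have "abs_trace K x ^ CHAR('a) + x = x + (\<Sum>i<?f. x ^ (CHAR('a) ^ Suc i))"
    unfolding abs_trace_def freshmans_dream_sum[OF prime_CHAR_finite_field refl]
    by (simp add: mult.commute flip: power_mult)
  also have "\<dots> = (\<Sum>i<Suc ?f. x ^ (CHAR('a) ^ i))"
    by (subst sum.lessThan_Suc_shift) simp
  also have "\<dots> = abs_trace K x + x"
    using assms by (simp add: abs_trace_def mem_K_iff flip: card_K)
  finally show ?thesis by simp
qed

text \<open>The trace is a polynomial function of degree less than \<open>q\<close>.\<close>

lemma abs_trace_nonzero: obtains x where "x \<in> K" "abs_trace K x \<noteq> 0"
proof -
  let ?p = "CHAR('a)" and ?f = "prime_degree K"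
  have p_gt_1: "?p > 1" using prime_CHAR_finite_field[where ?'a = 'a] prime_gt_1_nat by blast
  define P where "P = (\<Sum>i<?f. Polynomial.monom (1::'a) (?p ^ i))"
  have poly_P: "poly P x = abs_trace K x" for x
    by (simp add: P_def poly_sum poly_monom abs_trace_def)
  have "poly.coeff P (?p ^ (?f - 1)) = (\<Sum>i<?f. if i = ?f - 1 then 1 else 0)"
    unfolding P_def coeff_sum coeff_monom using p_gt_1 by (intro sum.cong) auto
  also have "\<dots> = 1" using prime_degree_pos by simp
  finally have "P \<noteq> 0" by auto
  have "degree P \<le> ?p ^ (?f - 1)"
    unfolding P_def using p_gt_1
    by (intro degree_sum_le order.trans[OF degree_monom_le] power_increasing) auto
  also have "\<dots> < q"
    unfolding card_K using p_gt_1 prime_degree_pos by (intro power_strict_increasing) auto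
  finally have "card {x. poly P x = 0} < q"
    using card_poly_roots_bound[OF \<open>P \<noteq> 0\<close>] by linarith
  then have "\<not> K \<subseteq> {x. poly P x = 0}" using card_mono[of "{x. poly P x = 0}" K] by auto
  then show ?thesis using that poly_P by auto
qed

abbreviation \<psi> :: "'a \<Rightarrow> complex" where "\<psi> \<equiv> canonical_add_char K"

lemma add_char_add:
  assumes "x \<in> K" "y \<in> K"
  shows "\<psi> (x + y) = \<psi> x * \<psi> y"
proof -
  let ?p = "CHAR('a)"
  let ?t = "\<lambda>x. prime_field_lift (abs_trace K x)"
  have "of_nat (?t x + ?t y) = (of_nat (?t (x + y)) :: 'a)"
    using assms K_closed(1)[OF assms]
    by (simp add: of_nat_prime_field_lift abs_trace_power_CHAR)
      (simp add: abs_trace_add)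
  then have "(?t x + ?t y) mod ?p = ?t (x + y) mod ?p"
    by (simp only: of_nat_eq_iff_cong_CHAR cong_def)
  then have "exp (2 * of_real pi * \<i> * of_nat (?t x + ?t y) / of_nat ?p) = \<psi> (x + y)"
    unfolding canonical_add_char_def
    using prime_CHAR_finite_field[where ?'a = 'a]
    by (subst complex_root_unity_eq) (auto dest: prime_ge_1_nat)
  then show ?thesis
    by (simp add: canonical_add_char_def ring_distribs add_divide_distrib exp_add)
qed

lemma add_char_nontrivial: obtains x where "x \<in> K" "\<psi> x \<noteq> 1"
proof -
  obtain x where trace_x: "x \<in> K" "abs_trace K x \<noteq> 0" by (rule abs_trace_nonzero)
  let ?t = "prime_field_lift (abs_trace K x)"
  have lift_t: "?t < CHAR('a)" "of_nat ?t = abs_trace K x"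
    using trace_x(1)
    by (simp_all add: prime_field_lift_less_CHAR of_nat_prime_field_lift abs_trace_power_CHAR)
  have "?t \<noteq> 0" using lift_t(2) trace_x(2) by (metis of_nat_0)
  then have "\<not> CHAR('a) dvd ?t" using lift_t(1) by (auto dest: dvd_imp_le)
  moreover have "1 \<le> CHAR('a)" using lift_t(1) by simp
  ultimately have "\<psi> x \<noteq> 1"
    unfolding canonical_add_char_def by (subst complex_root_unity_eq_1)
  with trace_x(1) that show ?thesis by blast
qed

lemma add_char_sum:
  assumes c_in_K: "c \<in> K"
  shows "(\<Sum>x\<in>K. \<psi> (x * c)) = (if c = 0 then of_nat q else 0)"
proof (cases "c = 0")
  case True
  have "\<psi> 0 * \<psi> 0 = \<psi> 0" using add_char_add[of 0 0] zero_in_K by simp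
  then have "\<psi> 0 = 1" by (simp add: canonical_add_char_def)
  then show ?thesis using True by simp
next
  case False
  obtain y where psi_y: "y \<in> K" "\<psi> y \<noteq> 1" by (rule add_char_nontrivial)
  have "(\<Sum>x\<in>K. \<psi> x) = (\<Sum>x\<in>K. \<psi> (x + y))"
    using sum.reindex_bij_betw[OF bij_betw_add_K[OF psi_y(1)], of \<psi>] by simp
  also have "\<dots> = (\<Sum>x\<in>K. \<psi> x) * \<psi> y"
    by (simp add: add_char_add psi_y(1) sum_distrib_right)
  finally have "(\<Sum>x\<in>K. \<psi> x) = 0" using psi_y(2) by simp
  then show ?thesis
    using sum.reindex_bij_betw[OF bij_betw_mult_K[of c], of \<psi>] c_in_K False by simp
qed

end

lemma mult_char_mult:
  assumes "mult_char UNIV \<kappa>" "x \<noteq> 0" "y \<noteq> 0"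
  shows "\<kappa> (x * y) = \<kappa> x * \<kappa> y"
  using assms by (simp add: mult_char_def)

lemma mult_char_nonzero:
  assumes "mult_char UNIV \<kappa>" "x \<noteq> 0"
  shows "\<kappa> x \<noteq> 0"
  using assms by (simp add: mult_char_def)

lemma mult_char_divide:
  assumes "mult_char UNIV \<kappa>" "x \<noteq> 0" "y \<noteq> 0"
  shows "\<kappa> (x / y) = \<kappa> x / \<kappa> y"
  using mult_char_mult[OF assms(1), of "x / y" y] mult_char_nonzero[OF assms(1,3)] assms(2,3)
  by (simp add: field_simps)

lemma mult_char_one:
  assumes "mult_char UNIV \<kappa>"
  shows "\<kappa> 1 = 1"
  using mult_char_divide[OF assms, of 1 1] mult_char_nonzero[OF assms, of 1] by simp

lemma mult_char_power:
  assumes "mult_char UNIV \<kappa>" "x \<noteq> 0"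
  shows "\<kappa> (x ^ n) = \<kappa> x ^ n"
  using assms by (induction n) (simp_all add: mult_char_one mult_char_mult)

lemma mult_char_power_int:
  assumes "mult_char UNIV \<kappa>" "x \<noteq> 0"
  shows "\<kappa> (x powi n) = \<kappa> x powi n"
proof (cases n rule: int_cases2)
  case (nonneg k)
  then show ?thesis using assms by (simp add: mult_char_power)
next
  case (nonpos k)
  then show ?thesis
    using mult_char_divide[OF assms(1), of 1 "x ^ k"] assms
    by (simp add: mult_char_one mult_char_power power_int_minus inverse_eq_divide)
qed

lemma mult_char_subset: "mult_char L \<kappa> \<Longrightarrow> K \<subseteq> L \<Longrightarrow> mult_char K \<kappa>"
  by (auto simp: mult_char_def)

lemma mult_char_sum_eq_0:
  assumes "is_subfield K" "mult_char K \<kappa>" "k \<in> K - {0}" "\<kappa> k \<noteq> 1"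
  shows "(\<Sum>x\<in>K - {0}. \<kappa> x) = 0"
proof -
  have "(\<Sum>x\<in>K - {0}. \<kappa> x) = (\<Sum>x\<in>K - {0}. \<kappa> (k * x))"
    using sum.reindex_bij_betw[OF bij_betw_mult_subfield_units[OF assms(1,3)], of \<kappa>] by simp
  also have "\<dots> = \<kappa> k * (\<Sum>x\<in>K - {0}. \<kappa> x)"
    using assms(2,3) by (simp add: mult_char_def sum_distrib_left)
  finally show ?thesis using assms(4) by simp
qed

context finite_subfield
begin

definition mult_char_fourier :: "('a \<Rightarrow> complex) \<Rightarrow> 'a \<Rightarrow> complex" where
  "mult_char_fourier \<eta> c = (\<Sum>x\<in>K - {0}. \<eta> x * \<psi> (c * x))"

lemma mult_char_fourier_scale:
  assumes mult_char: "mult_char K \<eta>" and c_unit: "c \<in> K - {0}"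
  shows "\<eta> c * mult_char_fourier \<eta> c = gauss_sum K \<eta>"
proof -
  have "gauss_sum K \<eta> = (\<Sum>x\<in>K - {0}. \<eta> (c * x) * \<psi> (c * x))"
    using sum.reindex_bij_betw[OF bij_betw_mult_subfield_units[OF subfield c_unit], of "\<lambda>x. \<eta> x * \<psi> x"]
    by (simp add: gauss_sum_def)
  also have "\<dots> = \<eta> c * mult_char_fourier \<eta> c"
    unfolding mult_char_fourier_def sum_distrib_left
    using mult_char c_unit by (intro sum.cong) (auto simp: mult_char_def)
  finally show ?thesis ..
qed

lemma mult_char_fourier_inversion:
  assumes "z \<in> K - {0}"
  shows "(\<Sum>c\<in>K. \<psi> (- (c * z)) * mult_char_fourier \<eta> c) = of_nat q * \<eta> z"
proof -
  have shift: "\<psi> (- (c * z)) * \<psi> (c * x) = \<psi> (c * (x - z))" if "c \<in> K" "x \<in> K - {0}" for c x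
    using that assms add_char_add[of "- (c * z)" "c * x"]
    by (simp add: K_closed K_uminus algebra_simps)
  have "(\<Sum>c\<in>K. \<psi> (- (c * z)) * mult_char_fourier \<eta> c) =
      (\<Sum>c\<in>K. \<Sum>x\<in>K - {0}. \<eta> x * \<psi> (c * (x - z)))"
    unfolding mult_char_fourier_def sum_distrib_left
    by (intro sum.cong refl) (simp add: mult.left_commute shift)
  also have "\<dots> = (\<Sum>x\<in>K - {0}. \<eta> x * (\<Sum>c\<in>K. \<psi> (c * (x - z))))"
    by (subst sum.swap) (simp add: sum_distrib_left)
  also have "\<dots> = (\<Sum>x\<in>K - {0}. if x = z then \<eta> z * of_nat q else 0)"
    using assms by (intro sum.cong refl) (simp add: add_char_sum K_closed)
  also have "\<dots> = of_nat q * \<eta> z" using assms by simp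
  finally show ?thesis .
qed

text \<open>If the Gauss sum vanished, so would the whole Fourier transform of the multiplicative
  character.\<close>

lemma gauss_sum_nonzero:
  assumes mult_char: "mult_char K \<eta>" and nontrivial: "k \<in> K - {0}" "\<eta> k \<noteq> 1"
  shows "gauss_sum K \<eta> \<noteq> 0"
proof
  assume zero: "gauss_sum K \<eta> = 0"
  have "mult_char_fourier \<eta> c = 0" if "c \<in> K" for c
  proof (cases "c = 0")
    case True
    then show ?thesis
      using mult_char_sum_eq_0[OF subfield mult_char nontrivial]
      by (simp add: mult_char_fourier_def flip: sum_distrib_right)
  next
    case False
    then show ?thesis
      using mult_char_fourier_scale[OF mult_char, of c] mult_char that zero by (auto simp: mult_char_def)
  qed
  then have "of_nat q * \<eta> 1 = 0"
    using mult_char_fourier_inversion[of 1 \<eta>] one_in_K by simp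
  then show False using mult_char one_in_K q_gt_1 by (auto simp: mult_char_def)
qed

end

section \<open>Quadratic extensions and Eisenstein sums\<close>

locale quadratic_extension = finite_subfield K for K :: "'a::{field,finite} set" +
  assumes card_field: "CARD('a) = (card K)\<^sup>2"
begin

lemma frobenius_frobenius: "((x::'a) ^ q) ^ q = x"
  using subfield_power_card[OF is_subfield_UNIV, of x]
  by (simp add: card_field power2_eq_square flip: power_mult)

lemma trace_in_K: "x + x ^ q \<in> K" and norm_in_K: "x * x ^ q \<in> K"
  by (simp_all add: mem_K_iff frobenius_add frobenius_frobenius add.commute mult.commute
      power_mult_distrib)

lemma abs_trace_UNIV: "abs_trace UNIV (x::'a) = abs_trace K (x + x ^ q)"
proof -
  let ?f = "prime_degree K" and ?g = "\<lambda>i. x ^ (CHAR('a) ^ i)"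
  have "prime_degree (UNIV :: 'a set) = ?f + ?f"
    by (rule prime_degree_eqI) (simp add: card_field card_K power2_eq_square power_add)
  then have "abs_trace UNIV x = sum ?g {0..<?f} + sum ?g {0 + ?f..<?f + ?f}"
    by (simp add: abs_trace_def sum.atLeastLessThan_concat lessThan_atLeast0)
  also have "sum ?g {0 + ?f..<?f + ?f} = abs_trace K (x ^ q)"
    unfolding sum.shift_bounds_nat_ivl
    by (simp add: abs_trace_def lessThan_atLeast0 card_K power_add mult.commute flip: power_mult)
  finally show ?thesis unfolding abs_trace_add by (simp add: abs_trace_def lessThan_atLeast0)
qed

lemma canonical_add_char_UNIV: "canonical_add_char UNIV x = \<psi> (x + x ^ q)"
  by (simp add: canonical_add_char_def abs_trace_UNIV)

definition trace_fiber :: "'a \<Rightarrow> 'a set" where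
  "trace_fiber c = {z. z \<noteq> 0 \<and> z + z ^ q = c}"

definition eisenstein_sum :: "('a \<Rightarrow> complex) \<Rightarrow> complex" where
  "eisenstein_sum \<kappa> = sum \<kappa> (trace_fiber 1)"

lemma sum_trace_fiber_scale:
  assumes mult_char: "mult_char UNIV \<kappa>" and k_unit: "k \<in> K - {0}"
  shows "sum \<kappa> (trace_fiber (k * c)) = \<kappa> k * sum \<kappa> (trace_fiber c)"
proof -
  have "k ^ q = k" using k_unit mem_K_iff by simp
  then have "bij_betw ((*) k) (trace_fiber c) (trace_fiber (k * c))"
    unfolding trace_fiber_def using k_unit
    by (intro bij_betw_byWitness[where f' = "\<lambda>z. z / k"])
      (auto simp: power_mult_distrib power_divide simp flip: distrib_left add_divide_distrib)
  from sum.reindex_bij_betw[OF this, of \<kappa>]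
  have "sum \<kappa> (trace_fiber (k * c)) = (\<Sum>z\<in>trace_fiber c. \<kappa> (k * z))" by simp
  also have "\<dots> = \<kappa> k * sum \<kappa> (trace_fiber c)"
    unfolding sum_distrib_left
    using k_unit by (intro sum.cong) (auto simp: trace_fiber_def mult_char_mult[OF mult_char])
  finally show ?thesis .
qed

lemma sum_group_by_trace:
  fixes \<kappa> g :: "'a \<Rightarrow> 'b::semiring_0"
  shows "(\<Sum>z\<in>UNIV - {0}. \<kappa> z * g (z + z ^ q)) = (\<Sum>c\<in>K. sum \<kappa> (trace_fiber c) * g c)"
proof -
  have "(\<Sum>z\<in>UNIV - {0}. \<kappa> z * g (z + z ^ q)) =
      (\<Sum>c\<in>K. \<Sum>z | z \<in> UNIV - {0} \<and> z + z ^ q = c. \<kappa> z * g (z + z ^ q))"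
    by (rule sum.group[symmetric]) (use trace_in_K in auto)
  also have "\<dots> = (\<Sum>c\<in>K. sum \<kappa> (trace_fiber c) * g c)"
    by (intro sum.cong) (auto simp: trace_fiber_def sum_distrib_right)
  finally show ?thesis .
qed

lemma sum_group_by_trace_eisenstein:
  assumes mult_char: "mult_char UNIV \<kappa>"
  shows "(\<Sum>z\<in>UNIV - {0}. \<kappa> z * g (z + z ^ q)) =
    sum \<kappa> (trace_fiber 0) * g 0 + eisenstein_sum \<kappa> * (\<Sum>c\<in>K - {0}. \<kappa> c * g c)"
proof -
  have "(\<Sum>c\<in>K - {0}. sum \<kappa> (trace_fiber c) * g c) =
      (\<Sum>c\<in>K - {0}. eisenstein_sum \<kappa> * (\<kappa> c * g c))"
    using sum_trace_fiber_scale[OF mult_char, of _ 1] by (intro sum.cong) (auto simp: eisenstein_sum_def)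
  then show ?thesis
    unfolding sum_group_by_trace using zero_in_K
    by (subst sum.remove[of _ 0]) (auto simp: sum_distrib_left)
qed

lemma gauss_sum_UNIV_eq:
  assumes mult_char: "mult_char UNIV \<kappa>" and nontrivial: "k \<in> K - {0}" "\<kappa> k \<noteq> 1"
  shows "gauss_sum UNIV \<kappa> = eisenstein_sum \<kappa> * gauss_sum K \<kappa>"
proof -
  have "sum \<kappa> (trace_fiber 0) = 0"
    using sum_trace_fiber_scale[OF mult_char nontrivial(1), of 0] nontrivial(2) by simp
  then show ?thesis
    using sum_group_by_trace_eisenstein[OF mult_char, of \<psi>]
    by (simp add: gauss_sum_def canonical_add_char_UNIV)
qed

lemma eisenstein_sum_trivial_on_K:
  assumes mult_char: "mult_char UNIV \<kappa>" and trivial: "\<And>k. k \<in> K - {0} \<Longrightarrow> \<kappa> k = 1"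
    and nontrivial: "w \<noteq> 0" "\<kappa> w \<noteq> 1" and trace_zero: "t \<noteq> 0" "t ^ q = - t"
  shows "eisenstein_sum \<kappa> = - \<kappa> t"
proof -
  have "bij_betw (\<lambda>k. k * t) (K - {0}) (trace_fiber 0)"
    using trace_zero
    by (intro bij_betw_byWitness[where f' = "\<lambda>z. z / t"])
      (auto simp: trace_fiber_def mem_K_iff power_mult_distrib power_divide add_eq_0_iff)
  from sum.reindex_bij_betw[OF this, of \<kappa>]
  have "sum \<kappa> (trace_fiber 0) = (\<Sum>k\<in>K - {0}. \<kappa> t)"
    using trivial trace_zero(1) by (simp add: mult_char_mult[OF mult_char])
  moreover have "(\<Sum>z\<in>UNIV - {0}. \<kappa> z) = 0"
    using mult_char_sum_eq_0[OF is_subfield_UNIV mult_char, of w] nontrivial by simp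
  ultimately have "eisenstein_sum \<kappa> * of_nat (card (K - {0})) = - \<kappa> t * of_nat (card (K - {0}))"
    using sum_group_by_trace_eisenstein[OF mult_char, of "\<lambda>_. 1"] trivial
    by (simp add: algebra_simps add_eq_0_iff)
  moreover have "card (K - {0}) \<noteq> 0"
    using one_in_K by auto
  ultimately show ?thesis by (simp only: mult_right_cancel of_nat_eq_0_iff not_False_eq_True)
qed

lemma frobenius_alternating:
  "(a * b ^ q - a ^ q * b :: 'a) ^ q = - (a * b ^ q - a ^ q * b)"
  by (simp add: frobenius_diff power_mult_distrib frobenius_frobenius mult.commute)

lemma affine_line_in_trace_fiber:
  assumes det: "d = a * b ^ q - a ^ q * b" "d \<noteq> 0" and y_in_K: "y \<in> K"
  shows "(a + y * b) * b ^ q / d \<in> trace_fiber 1"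
proof -
  define z where "z = (a + y * b) * b ^ q / d"
  have "z ^ q = - ((a ^ q + y * b ^ q) * b / d)"
    using y_in_K frobenius_alternating[of a b]
    by (simp add: z_def power_mult_distrib power_divide frobenius_add frobenius_frobenius
        mem_K_iff flip: det(1))
  then have "z + z ^ q = ((a + y * b) * b ^ q - (a ^ q + y * b ^ q) * b) / d"
    by (simp add: z_def diff_divide_distrib)
  also have "\<dots> = 1" using det(2) by (simp add: det(1) algebra_simps)
  finally have "z + z ^ q = 1" .
  moreover from this have "z \<noteq> 0" by (intro notI) (simp add: power_0_left)
  ultimately show ?thesis by (simp add: trace_fiber_def z_def)
qed

lemma trace_fiber_on_affine_line:
  assumes det: "d = a * b ^ q - a ^ q * b" and z_in_fiber: "z \<in> trace_fiber 1"
  shows "(z * d - a * b ^ q) / (b * b ^ q) \<in> K"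
proof (rule K_closed(4)[OF _ norm_in_K])
  have frobenius_z: "z ^ q = 1 - z" using z_in_fiber by (simp add: trace_fiber_def algebra_simps)
  have "(z * d - a * b ^ q) ^ q = (1 - z) * - d - a ^ q * b"
    using frobenius_alternating[of a b]
    by (simp only: frobenius_diff power_mult_distrib frobenius_frobenius frobenius_z flip: det)
  also have "\<dots> = z * d - a * b ^ q" by (simp add: det algebra_simps)
  finally show "z * d - a * b ^ q \<in> K" by (simp add: mem_K_iff)
qed

lemma bij_betw_affine_line_trace_fiber:
  assumes det: "d = a * b ^ q - a ^ q * b" "d \<noteq> 0"
  shows "bij_betw (\<lambda>y. (a + y * b) * b ^ q / d) K (trace_fiber 1)"
proof (rule bij_betw_byWitness[where f' = "\<lambda>z. (z * d - a * b ^ q) / (b * b ^ q)"])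
  show "(\<lambda>y. (a + y * b) * b ^ q / d) ` K \<subseteq> trace_fiber 1"
    using affine_line_in_trace_fiber[OF det] by blast
  show "(\<lambda>z. (z * d - a * b ^ q) / (b * b ^ q)) ` trace_fiber 1 \<subseteq> K"
    using trace_fiber_on_affine_line[OF det(1)] by blast
  have "b \<noteq> 0" using det by auto
  then show "\<forall>y\<in>K. ((a + y * b) * b ^ q / d * d - a * b ^ q) / (b * b ^ q) = y"
    "\<forall>z\<in>trace_fiber 1. (a + (z * d - a * b ^ q) / (b * b ^ q) * b) * b ^ q / d = z"
    using det(2) by (simp_all add: field_simps)
qed

lemma sum_affine_line:
  assumes mult_char: "mult_char UNIV \<kappa>" and indep: "a * b ^ q - a ^ q * b \<noteq> 0"
  shows "(\<Sum>y\<in>K. \<kappa> (a + y * b)) = \<kappa> (a * b ^ q - a ^ q * b) / \<kappa> (b ^ q) * eisenstein_sum \<kappa>"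
proof -
  define d where "d = a * b ^ q - a ^ q * b"
  have d_nonzero: "d \<noteq> 0" using indep by (simp add: d_def)
  then have b_nonzero: "b \<noteq> 0" "b ^ q \<noteq> 0" by (auto simp: d_def)
  have "(\<Sum>y\<in>K. \<kappa> (a + y * b)) = (\<Sum>y\<in>K. \<kappa> (d / b ^ q * ((a + y * b) * b ^ q / d)))"
    using b_nonzero d_nonzero by simp
  also have "\<dots> = (\<Sum>z\<in>trace_fiber 1. \<kappa> (d / b ^ q * z))"
    using sum.reindex_bij_betw[OF bij_betw_affine_line_trace_fiber[OF d_def d_nonzero],
        of "\<lambda>z. \<kappa> (d / b ^ q * z)"] .
  also have "\<dots> = \<kappa> (d / b ^ q) * eisenstein_sum \<kappa>"
    unfolding eisenstein_sum_def sum_distrib_left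
    using b_nonzero d_nonzero
    by (intro sum.cong refl mult_char_mult[OF mult_char]) (auto simp: trace_fiber_def)
  finally show ?thesis
    unfolding mult_char_divide[OF mult_char d_nonzero b_nonzero(2)] unfolding d_def .
qed

lemma one_plus_mult_nonzero:
  assumes "A \<notin> K" "x \<in> K"
  shows "1 + x * A \<noteq> 0"
proof
  assume "1 + x * A = 0"
  then have "A = - 1 / x"
    by (cases "x = 0") (simp_all add: field_simps eq_neg_iff_add_eq_0 add.commute)
  with assms show False using K_closed(4)[OF K_uminus[OF one_in_K]] by blast
qed

lemma sum_one_plus_mult:
  assumes mult_char: "mult_char UNIV \<kappa>" and A_notin_K: "A \<notin> K"
  shows "(\<Sum>x\<in>K. \<kappa> (1 + x * A)) = \<kappa> (A ^ q - A) / \<kappa> (A ^ q) * eisenstein_sum \<kappa>"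
  using sum_affine_line[OF mult_char, of 1 A] A_notin_K by (simp add: mem_K_iff)

text \<open>With \<open>y = 1 / (x - s)\<close> one has \<open>(1 + x * A) / (x - s) = A + y * (1 + s * A)\<close>, so this is again
  a sum over an affine line, with the point \<open>y = 0\<close> removed.\<close>

lemma sum_one_plus_mult_over_diff:
  assumes mult_char: "mult_char UNIV \<kappa>" and A_notin_K: "A \<notin> K" and s_in_K: "s \<in> K"
  shows "(\<Sum>x\<in>K - {s}. \<kappa> ((1 + x * A) / (x - s))) =
    \<kappa> (A - A ^ q) / \<kappa> ((1 + s * A) ^ q) * eisenstein_sum \<kappa> - \<kappa> A"
proof -
  let ?u = "1 + s * A"
  have det: "A * ?u ^ q - A ^ q * ?u = A - A ^ q"
    using s_in_K by (simp add: frobenius_add power_mult_distrib mem_K_iff algebra_simps)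
  have bij_inverse: "bij_betw (\<lambda>x. 1 / (x - s)) (K - {s}) (K - {0})"
    by (rule bij_betw_byWitness[where f' = "\<lambda>y. s + 1 / y"])
      (use s_in_K in \<open>auto intro!: K_closed one_in_K\<close>)
  have "(\<Sum>x\<in>K - {s}. \<kappa> ((1 + x * A) / (x - s))) = (\<Sum>x\<in>K - {s}. \<kappa> (A + 1 / (x - s) * ?u))"
    by (intro sum.cong refl arg_cong[where f = \<kappa>]) (simp add: field_simps)
  also have "\<dots> = (\<Sum>y\<in>K - {0}. \<kappa> (A + y * ?u))"
    using sum.reindex_bij_betw[OF bij_inverse, of "\<lambda>y. \<kappa> (A + y * ?u)"] .
  also have "\<dots> = (\<Sum>y\<in>K. \<kappa> (A + y * ?u)) - \<kappa> A"
    using zero_in_K by (simp add: sum_diff1)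
  also have "(\<Sum>y\<in>K. \<kappa> (A + y * ?u)) = \<kappa> (A - A ^ q) / \<kappa> (?u ^ q) * eisenstein_sum \<kappa>"
    using sum_affine_line[OF mult_char, of A ?u] A_notin_K unfolding det by (simp add: mem_K_iff)
  finally show ?thesis .
qed

lemma sum_one_plus_mult_trivial_on_K:
  assumes mult_char: "mult_char UNIV \<kappa>" and trivial: "\<And>k. k \<in> K - {0} \<Longrightarrow> \<kappa> k = 1"
    and nontrivial: "w \<noteq> 0" "\<kappa> w \<noteq> 1" and A_notin_K: "A \<notin> K"
  shows "(\<Sum>x\<in>K. \<kappa> (1 + x * A)) = - \<kappa> A"
proof -
  define t where "t = A ^ q - A"
  have trace_zero: "t \<noteq> 0" "t ^ q = - t"
    using A_notin_K by (simp_all add: t_def mem_K_iff frobenius_diff frobenius_frobenius)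
  have A_nonzero: "A \<noteq> 0" "A ^ q \<noteq> 0" using A_notin_K zero_in_K by auto
  have "(t * t) ^ q = t * t" using trace_zero(2) by (simp add: power_mult_distrib)
  then have "\<kappa> t * \<kappa> t = 1"
    using trivial[of "t * t"] trace_zero(1) by (simp add: mem_K_iff mult_char_mult[OF mult_char])
  moreover have "\<kappa> A * \<kappa> (A ^ q) = 1"
    using trivial[OF DiffI, OF norm_in_K[of A]] A_nonzero by (simp add: mult_char_mult[OF mult_char])
  ultimately show ?thesis
    using eisenstein_sum_trivial_on_K[OF mult_char trivial nontrivial trace_zero]
      mult_char_nonzero[OF mult_char A_nonzero(2)]
    by (simp add: sum_one_plus_mult[OF mult_char A_notin_K] t_def field_simps)
qed

end

lemma quadratic_extension_intro:
  fixes K :: "'a::{field,finite} set"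
  assumes "is_subfield K" "primepow (card K)" "CARD('a) = (card K)\<^sup>2"
  shows "quadratic_extension K"
proof
  obtain r k where prime_power: "prime r" "card K = r ^ k"
    using assms(2) by (auto simp: primepow_def)
  have "CHAR('a) dvd r ^ (k * 2)"
    using CHAR_dvd_CARD[where ?'a = 'a] by (simp add: assms(3) prime_power(2) power_mult)
  then have "CHAR('a) = r"
    using prime_CHAR_finite_field[where ?'a = 'a] prime_power(1) prime_dvd_power primes_dvd_imp_eq
    by blast
  then have "card K = CHAR('a) ^ k" using prime_power(2) by simp
  then show "card K = CHAR('a) ^ prime_degree K" by (simp add: prime_degree_eqI)
qed (use assms in simp_all)

section \<open>Primitive elements\<close>

lemma primitive_element_nonzero:
  assumes "primitive_element w"
  shows "w \<noteq> 0"
proof -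
  have "w ^ 1 \<in> range (\<lambda>k::nat. w ^ k)" by (rule rangeI)
  then show ?thesis using assms by (simp add: primitive_element_def)
qed

lemma primitive_element_powerE:
  assumes "primitive_element w" "x \<noteq> 0"
  obtains n :: nat where "x = w ^ n"
proof -
  have "x \<in> range (\<lambda>k::nat. w ^ k)" using assms by (simp add: primitive_element_def)
  with that show ?thesis by blast
qed

lemma power_mod_eq_if_power_eq_1:
  fixes w :: "'a::monoid_mult"
  assumes "w ^ r = 1"
  shows "w ^ (k mod r) = w ^ k"
proof -
  have "w ^ k = w ^ (r * (k div r) + k mod r)" by simp
  then show ?thesis by (simp only: power_add power_mult assms power_one mult_1)
qed

lemma primitive_element_order_ge:
  fixes w :: "'a::{field,finite}"
  assumes "primitive_element w" "w ^ r = 1" "r > 0"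
  shows "CARD('a) - 1 \<le> r"
proof -
  have "w ^ k \<in> (\<lambda>k. w ^ k) ` {..<r}" for k
    using power_mod_eq_if_power_eq_1[OF assms(2), of k] assms(3)
    by (intro image_eqI[of _ _ "k mod r"]) simp_all
  then have "range (\<lambda>k. w ^ k) \<subseteq> (\<lambda>k. w ^ k) ` {..<r}" by blast
  then have "UNIV - {0} \<subseteq> (\<lambda>k. w ^ k) ` {..<r}"
    using assms(1) by (simp add: primitive_element_def)
  then have "card (UNIV - {0 :: 'a}) \<le> card {..<r}"
    by (intro surj_card_le) simp_all
  then show ?thesis by (simp add: card_Diff_singleton)
qed

lemma primitive_element_power_eq_1_iff:
  fixes w :: "'a::{field,finite}"
  assumes primitive: "primitive_element w"
  shows "w ^ n = 1 \<longleftrightarrow> CARD('a) - 1 dvd n"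
proof
  let ?d = "CARD('a) - 1"
  have order: "w ^ ?d = 1"
    using subfield_power_card_minus_1[OF is_subfield_UNIV, of w] primitive_element_nonzero[OF primitive]
    by simp
  show "w ^ n = 1" if "?d dvd n"
    using that order by (auto simp: power_mult)
  assume "w ^ n = 1"
  then have "w ^ (n mod ?d) = 1" by (simp only: power_mod_eq_if_power_eq_1[OF order])
  moreover have "card {0, 1 :: 'a} \<le> CARD('a)" by (rule card_mono) auto
  then have "n mod ?d < ?d" by (intro mod_less_divisor) simp
  ultimately have "n mod ?d = 0"
    using primitive_element_order_ge[OF primitive, of "n mod ?d"] by linarith
  then show "?d dvd n" by (simp only: dvd_eq_mod_eq_0)
qed

lemma primitive_element_powi_eq_1_iff:
  fixes w :: "'a::{field,finite}"
  assumes "primitive_element w"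
  shows "w powi n = 1 \<longleftrightarrow> int CARD('a) - 1 dvd n"
proof -
  have "int CARD('a) - 1 dvd int k \<longleftrightarrow> CARD('a) - 1 dvd k" for k
    by (simp add: of_nat_diff flip: int_dvd_int_iff)
  then show ?thesis
    by (cases n rule: int_cases2)
      (simp_all add: power_int_minus primitive_element_power_eq_1_iff[OF assms])
qed

lemma (in quadratic_extension) primitive_element_powi_in_K_iff:
  assumes "primitive_element w"
  shows "w powi n \<in> K \<longleftrightarrow> int q + 1 dvd n"
proof -
  have w_nonzero: "w \<noteq> 0" by (rule primitive_element_nonzero[OF assms])
  have "w powi n \<in> K \<longleftrightarrow> w powi (n * int q) = w powi n"
    by (simp add: mem_K_iff power_int_mult)
  also have "\<dots> \<longleftrightarrow> w powi (n * (int q - 1)) = 1"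
    using w_nonzero by (simp add: right_diff_distrib power_int_diff)
  also have "\<dots> \<longleftrightarrow> int CARD('a) - 1 dvd n * (int q - 1)"
    by (rule primitive_element_powi_eq_1_iff[OF assms])
  also have "int CARD('a) - 1 = (int q + 1) * (int q - 1)"
    by (simp add: card_field power2_eq_square algebra_simps)
  also have "\<dots> dvd n * (int q - 1) \<longleftrightarrow> int q + 1 dvd n"
    using q_gt_1 by simp
  finally show ?thesis .
qed

section \<open>Primitive eighth roots of unity\<close>

lemma power2_eq_2_notin_Rats:
  assumes "x\<^sup>2 = (2::real)"
  shows "x \<notin> \<rat>"
proof
  assume "x \<in> \<rat>"
  then obtain a b :: nat where "b \<noteq> 0" and abs_x: "\<bar>x\<bar> = a / b"
    by (rule Rats_abs_nat_div_natE)
  have "2 = (real a / real b)\<^sup>2" using assms by (simp flip: abs_x)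
  with \<open>b \<noteq> 0\<close> have "real (2 * b\<^sup>2) = real (a\<^sup>2)"
    by (simp add: power_divide field_simps)
  then have squares_eq: "2 * b\<^sup>2 = a\<^sup>2" by (simp only: of_nat_eq_iff)
  with \<open>b \<noteq> 0\<close> have "a \<noteq> 0" by (intro notI) simp
  have "1 + 2 * multiplicity 2 b = multiplicity 2 (2 * b\<^sup>2)"
    using \<open>b \<noteq> 0\<close>
    by (simp add: prime_elem_multiplicity_mult_distrib prime_elem_multiplicity_power_distrib)
  also have "\<dots> = 2 * multiplicity 2 a"
    using \<open>a \<noteq> 0\<close> by (simp add: squares_eq prime_elem_multiplicity_power_distrib)
  finally show False by presburger
qed

lemma rat_lin_indep_1_irrational:
  assumes "x \<notin> \<rat>" "of_rat a + of_rat b * x = (0::real)"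
  shows "a = 0 \<and> b = 0"
proof -
  have "b = 0"
  proof (rule ccontr)
    assume "b \<noteq> 0"
    then have "x = of_rat (- a / b)"
      using assms(2) by (simp add: of_rat_divide of_rat_minus field_simps)
    then show False using assms(1) Rats_of_rat by metis
  qed
  then show ?thesis using assms(2) by simp
qed

lemma eighth_root_Re_Im:
  fixes z :: complex
  assumes "z ^ 4 = - 1"
  shows "(Re z)\<^sup>2 = 1 / 2" "(Im z)\<^sup>2 = 1 / 2"
proof -
  have "(z\<^sup>2)\<^sup>2 = - 1" using assms by simp
  then have "Re ((z\<^sup>2)\<^sup>2) = - 1" "Im ((z\<^sup>2)\<^sup>2) = 0" by simp_all
  then have diff_square: "((Re z)\<^sup>2 - (Im z)\<^sup>2)\<^sup>2 = 4 * (Re z)\<^sup>2 * (Im z)\<^sup>2 - 1"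
    and "((Re z)\<^sup>2 - (Im z)\<^sup>2) * (Re z * Im z) = 0"
    unfolding Re_power2 Im_power2 by (simp_all add: power_mult_distrib)
  moreover have "Re z * Im z \<noteq> 0"
  proof
    assume "Re z * Im z = 0"
    with diff_square have "((Re z)\<^sup>2 - (Im z)\<^sup>2)\<^sup>2 = - 1" by auto
    then show False using zero_le_power2[of "(Re z)\<^sup>2 - (Im z)\<^sup>2"] by linarith
  qed
  ultimately have squares_eq: "(Re z)\<^sup>2 = (Im z)\<^sup>2" by simp
  with diff_square have "((Im z)\<^sup>2)\<^sup>2 = (1 / 2)\<^sup>2" by (simp add: power2_eq_square)
  then have "(Im z)\<^sup>2 = 1 / 2" by (rule power2_eq_imp_eq) simp_all
  with squares_eq show "(Re z)\<^sup>2 = 1 / 2" "(Im z)\<^sup>2 = 1 / 2" by simp_all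
qed

lemma of_real_of_rat: "of_real (of_rat r) = (of_rat r :: 'a::real_field)"
  by (cases r) (simp add: of_rat_rat)

lemma eighth_root_rat_lin_indep:
  fixes z :: complex
  assumes z_power_4: "z ^ 4 = - 1"
    and relation: "of_rat a + of_rat b * z + of_rat c * z\<^sup>2 + of_rat d * z ^ 3 = 0"
  shows "a = 0 \<and> b = 0 \<and> c = 0 \<and> d = 0"
proof -
  define x y where "x = Re z" and "y = Im z"
  have squares: "x * x = 1 / 2" "y * y = 1 / 2"
    using eighth_root_Re_Im[OF z_power_4] by (simp_all add: x_def y_def power2_eq_square)
  have z_power_2: "z\<^sup>2 = Complex 0 (2 * x * y)"
    using squares by (simp add: complex_eq_iff Re_power2 Im_power2 x_def y_def power2_eq_square)
  have "z ^ 3 = z\<^sup>2 * z" by (simp add: eval_nat_numeral)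
  also have "\<dots> = Complex (- x) y"
    unfolding z_power_2 using squares by (simp add: complex_eq_iff flip: x_def y_def) algebra
  finally have z_power_3: "z ^ 3 = Complex (- x) y" .
  have "x \<notin> \<rat>"
  proof
    assume "x \<in> \<rat>"
    then have "2 * x \<in> \<rat>" by simp
    moreover have "(2 * x)\<^sup>2 = 2" using squares by (simp add: power2_eq_square)
    ultimately show False using power2_eq_2_notin_Rats by blast
  qed
  moreover have "of_rat a + of_rat (b - d) * x = 0"
    using arg_cong[OF relation, of Re]
    by (simp add: z_power_2 z_power_3 of_rat_diff algebra_simps x_def
        flip: of_real_of_rat[where 'a = complex])
  moreover have "y * (of_rat (b + d) + of_rat (2 * c) * x) = 0"
    using arg_cong[OF relation, of Im]
    by (simp add: z_power_2 z_power_3 of_rat_add of_rat_mult algebra_simps y_def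
        flip: of_real_of_rat[where 'a = complex])
  then have "of_rat (b + d) + of_rat (2 * c) * x = 0" using squares(2) by auto
  ultimately have "a = 0 \<and> b - d = 0" "b + d = 0 \<and> 2 * c = 0"
    using rat_lin_indep_1_irrational by blast+
  then show ?thesis by auto
qed

definition antiperiodic4 :: "(int \<Rightarrow> 'b::ring_1) \<Rightarrow> bool" where
  "antiperiodic4 \<phi> \<longleftrightarrow> (\<forall>n. \<phi> (n + 4) = - \<phi> n)"

lemma antiperiodic4_add_8_mult:
  assumes "antiperiodic4 \<phi>"
  shows "\<phi> (n + 8 * k) = \<phi> n"
proof -
  have period: "\<phi> (j + 8) = \<phi> j" for j
    using assms[unfolded antiperiodic4_def, rule_format, of "j + 4"]
      assms[unfolded antiperiodic4_def, rule_format, of j] by (simp add: add.commute)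
  show ?thesis
  proof (induction k rule: int_induct[where k = 0])
    case (step1 k)
    then show ?case using period[of "n + 8 * k"] by (simp add: algebra_simps)
  next
    case (step2 k)
    then show ?case using period[of "n + 8 * (k - 1)"] by (simp add: algebra_simps)
  qed simp
qed

lemma antiperiodic4_eqI:
  assumes "antiperiodic4 \<phi>" "antiperiodic4 \<theta>" and agree: "\<And>j. j \<in> {0, 1, 2, 3} \<Longrightarrow> \<phi> j = \<theta> j"
  shows "\<phi> n = \<theta> n"
proof -
  have "\<phi> r = \<theta> r" if r_range: "0 \<le> r" "r < 8" for r
  proof (cases "r < 4")
    case True
    with r_range show ?thesis by (intro agree) auto
  next
    case False
    with r_range have "\<phi> (r - 4) = \<theta> (r - 4)" by (intro agree) auto
    then show ?thesis
      using assms(1,2)[unfolded antiperiodic4_def, rule_format, of "r - 4"] by simp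
  qed
  then have "\<phi> (n mod 8) = \<theta> (n mod 8)" by simp
  then show ?thesis
    using antiperiodic4_add_8_mult[OF assms(1), of "n mod 8" "n div 8"]
      antiperiodic4_add_8_mult[OF assms(2), of "n mod 8" "n div 8"] by simp
qed

lemma antiperiodic4_eighth_root_powi:
  fixes z :: "'a::field"
  assumes "z ^ 4 = - 1"
  shows "antiperiodic4 (\<lambda>n. z powi n)"
proof -
  have "z \<noteq> 0" using assms by auto
  then show ?thesis using assms by (simp add: antiperiodic4_def power_int_add)
qed

lemma eighth_root_powi_eq_1_iff:
  fixes z :: "'a::field_char_0"
  assumes z_power_4: "z ^ 4 = - 1"
  shows "z powi n = 1 \<longleftrightarrow> 8 dvd n"
proof
  show "z powi n = 1" if "8 dvd n"
    using that antiperiodic4_add_8_mult[OF antiperiodic4_eighth_root_powi[OF z_power_4], of 0]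
    by auto
  have four_mult: "z powi (4 * j) = 1 \<longleftrightarrow> even j" for j
    by (simp add: power_int_mult z_power_4 power_int_minus_left)
  assume power_n: "z powi n = 1"
  then have "z powi (4 * n) = 1" by (simp add: mult.commute[of 4] power_int_mult)
  then have "even n" by (simp only: four_mult)
  then obtain j where n_eq: "n = 2 * j" by (rule evenE)
  have "4 * j = n * 2" by (simp add: n_eq)
  then have "z powi (4 * j) = 1" by (simp only: power_int_mult power_n power_int_1_left)
  then have "even j" by (simp only: four_mult)
  then obtain k where j_eq: "j = 2 * k" by (rule evenE)
  then have "even k" using power_n four_mult[of k] by (simp add: n_eq)
  then show "8 dvd n" by (auto simp: n_eq j_eq)
qed

lemma eighth_root_powi_eq_iff:
  fixes z :: "'a::field_char_0"
  assumes "z ^ 4 = - 1"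
  shows "z powi i = z powi j \<longleftrightarrow> [i = j] (mod 8)"
proof -
  have "z \<noteq> 0" using assms by auto
  then have "z powi i = z powi j \<longleftrightarrow> z powi (i - j) = 1"
    by (simp add: power_int_diff)
  then show ?thesis by (simp add: eighth_root_powi_eq_1_iff[OF assms] cong_iff_dvd_diff)
qed

lemma eighth_power_eq_1_powiE:
  fixes z w :: "'a::field_char_0"
  assumes z_power_4: "z ^ 4 = - 1" and w_power_8: "w ^ 8 = 1"
  obtains n where "0 \<le> n" "n < 8" "w = z powi n"
proof -
  have fourth_root: "\<exists>n. w = z powi n" if "w ^ 4 = 1" for w
  proof -
    have "w\<^sup>2 = 1\<^sup>2 \<or> w\<^sup>2 = (z\<^sup>2)\<^sup>2" using z_power_4 power2_eq_1_iff[of "w\<^sup>2"] that by simp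
    then have "w = z powi 0 \<or> w = z powi 4 \<or> w = z powi 2 \<or> w = z powi 6"
      using z_power_4 power_add[of z 4 2] unfolding power2_eq_iff by auto
    then show ?thesis by blast
  qed
  have "(w ^ 4)\<^sup>2 = 1\<^sup>2" using w_power_8 by simp
  then consider (one) "w ^ 4 = 1" | (minus_one) "w ^ 4 = - 1" unfolding power2_eq_iff by auto
  then obtain n where w_eq: "w = z powi n"
  proof cases
    case one
    then show ?thesis using fourth_root that by blast
  next
    case minus_one
    then have "(w / z) ^ 4 = 1" using z_power_4 by (simp add: power_divide)
    then obtain n where "w / z = z powi n" using fourth_root by blast
    moreover have "z \<noteq> 0" using z_power_4 by auto
    ultimately have "w = z powi (n + 1)" by (simp add: power_int_add nonzero_divide_eq_eq)
    then show ?thesis by (rule that)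
  qed
  have "w = z powi (n mod 8)"
    unfolding w_eq eighth_root_powi_eq_iff[OF z_power_4] by (simp add: cong_def)
  then show ?thesis by (intro that) auto
qed

lemma additive_of_int_mult:
  fixes \<Phi> :: "'a::ring_1 \<Rightarrow> 'b::ring_1"
  assumes "Modules.additive \<Phi>"
  shows "\<Phi> (of_int n * x) = of_int n * \<Phi> x"
proof -
  interpret Modules.additive \<Phi> by fact
  show ?thesis
    by (induction n rule: int_induct[where k = 0])
      (simp_all add: zero add diff distrib_right left_diff_distrib)
qed

text \<open>Since \<open>1, z, z\<^sup>2, z\<^sup>3\<close> are linearly independent over the rationals, integer relations between powers
  of \<open>z\<close> are preserved by \<open>z\<^sup>n \<mapsto> \<phi> n\<close>. This replaces the Galois conjugates of the character sums.\<close>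

lemma eighth_root_functional:
  fixes z :: complex and \<phi> :: "int \<Rightarrow> rat"
  assumes z_power_4: "z ^ 4 = - 1" and antiperiodic: "antiperiodic4 \<phi>"
  obtains \<Phi> :: "complex \<Rightarrow> rat" where "Modules.additive \<Phi>" "\<And>n. \<Phi> (z powi n) = \<phi> n"
proof -
  let ?scale = "\<lambda>r w. of_rat r * w :: complex" and ?scale_rat = "(*) :: rat \<Rightarrow> rat \<Rightarrow> rat"
  interpret vector_space_pair ?scale ?scale_rat
    by unfold_locales (simp_all add: of_rat_add of_rat_mult algebra_simps)
  let ?J = "{0, 1, 2, 3} :: int set"
  define B where "B = (\<lambda>j. z powi j) ` ?J"
  have inj: "inj_on (\<lambda>j. z powi j) ?J"
    by (auto simp: inj_on_def eighth_root_powi_eq_iff[OF z_power_4] cong_def)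
  have "vs1.independent B"
  proof (rule vs1.independent_if_scalars_zero)
    fix f w assume "(\<Sum>w\<in>B. of_rat (f w) * w) = 0" "w \<in> B"
    then have "(\<Sum>j\<in>?J. of_rat (f (z powi j)) * z powi j) = 0"
      by (simp only: B_def sum.reindex[OF inj] o_def)
    then have "f (z powi j) = 0" if "j \<in> ?J" for j
      using eighth_root_rat_lin_indep[OF z_power_4, of "f 1" "f z" "f (z\<^sup>2)" "f (z ^ 3)"] that
      by (auto simp: add.assoc)
    moreover obtain j where "j \<in> ?J" "w = z powi j" using \<open>w \<in> B\<close> unfolding B_def by blast
    ultimately show "f w = 0" by blast
  qed (simp add: B_def)
  then obtain \<Phi> where linear: "Vector_Spaces.linear ?scale ?scale_rat \<Phi>"
    and \<Phi>_B: "\<forall>w\<in>B. \<Phi> w = (\<phi> \<circ> the_inv_into ?J (\<lambda>j. z powi j)) w"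
    using linear_independent_extend by blast
  interpret \<Phi>: Vector_Spaces.linear ?scale ?scale_rat \<Phi> by (rule linear)
  have "Modules.additive \<Phi>" by unfold_locales (rule \<Phi>.add)
  moreover have "\<Phi> (z powi n) = \<phi> n" for n
  proof (rule antiperiodic4_eqI[OF _ antiperiodic])
    show "antiperiodic4 (\<lambda>n. \<Phi> (z powi n))"
      using antiperiodic4_eighth_root_powi[OF z_power_4] by (simp add: antiperiodic4_def \<Phi>.neg)
    show "\<Phi> (z powi j) = \<phi> j" if "j \<in> ?J" for j
    proof -
      have "z powi j \<in> B" unfolding B_def using that by (rule imageI)
      then show ?thesis using \<Phi>_B the_inv_into_f_f[OF inj that] by simp
    qed
  qed
  ultimately show ?thesis using that by blast
qed

definition sign8 :: "int \<Rightarrow> int" where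
  "sign8 n = (if n mod 8 < 4 then 1 else - 1)"

lemma antiperiodic4_sign8: "antiperiodic4 sign8"
proof -
  have "(n + 4) mod 8 < 4 \<longleftrightarrow> \<not> n mod 8 < 4" for n :: int by presburger
  then show ?thesis by (simp add: antiperiodic4_def sign8_def)
qed

definition residue_sign8 :: "int \<Rightarrow> int \<Rightarrow> int" where
  "residue_sign8 k n = 2 * of_bool ([n = k] (mod 8)) - of_bool ([n = k] (mod 4))"

lemma antiperiodic4_residue_sign8: "antiperiodic4 (residue_sign8 k)"
  unfolding antiperiodic4_def
proof
  fix n
  have "4 dvd d + 4 \<longleftrightarrow> 4 dvd d" "4 dvd d \<longleftrightarrow> 8 dvd d \<or> 8 dvd d + 4"
    "\<not> (8 dvd d \<and> 8 dvd d + 4)" for d :: int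
    by presburger+
  from this[of "n - k"] show "residue_sign8 k (n + 4) = - residue_sign8 k n"
    by (auto simp: residue_sign8_def cong_iff_dvd_diff diff_add_eq)
qed

lemma eighth_root_even_power_sum:
  fixes z :: "'a::field_char_0"
  assumes z_power_4: "z ^ 4 = - 1"
  shows "(\<Sum>j<4. z powi (2 * int j * n)) = 4 * of_bool (4 dvd n)"
proof -
  define w where "w = z powi (2 * n)"
  have "(\<Sum>j<4. z powi (2 * int j * n)) = (\<Sum>j<4. w ^ j)"
    by (intro sum.cong refl) (simp add: w_def power_int_power' mult_ac)
  moreover have "w = 1 \<longleftrightarrow> 4 dvd n"
    unfolding w_def eighth_root_powi_eq_1_iff[OF z_power_4] by presburger
  moreover have "w ^ 4 = z powi (8 * n)" by (simp add: w_def power_int_power' mult_ac)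
  then have "w ^ 4 = 1" by (simp add: eighth_root_powi_eq_1_iff[OF z_power_4])
  ultimately show ?thesis by (simp add: sum_gp_strict)
qed

definition zeta8 :: complex where
  "zeta8 = exp (2 * of_real pi * \<i> / 8)"

lemma zeta8_eq_cis: "zeta8 = cis (pi / 4)"
  by (simp add: zeta8_def cis_conv_exp)

lemma zeta8_power_2: "zeta8\<^sup>2 = \<i>"
  by (simp add: zeta8_eq_cis power2_eq_square cis_mult flip: cis_pi_half)

lemma zeta8_power_4: "zeta8 ^ 4 = - 1"
  using power_mult[of zeta8 2 2] by (simp add: zeta8_power_2)

lemma csqrt_minus_2: "csqrt (- 2) = zeta8 + zeta8 ^ 3"
proof -
  have sum_eq: "zeta8 + zeta8 ^ 3 = (1 + \<i>) * zeta8"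
    using zeta8_power_2 by (simp add: power3_eq_cube power2_eq_square algebra_simps)
  have "(1 + \<i>)\<^sup>2 = 2 * \<i>" by (simp add: power2_eq_square algebra_simps)
  then have "(zeta8 + zeta8 ^ 3)\<^sup>2 = - 2"
    unfolding sum_eq power_mult_distrib zeta8_power_2 by simp
  moreover have "Re (zeta8 + zeta8 ^ 3) = 0" "Im (zeta8 + zeta8 ^ 3) \<ge> 0"
    unfolding sum_eq by (simp_all add: zeta8_eq_cis cos_45 sin_45)
  ultimately show ?thesis by (metis csqrt_square)
qed

lemma
  assumes "\<sigma> \<in> {1, - 1 :: int}"
  shows zeta8_powi_sign_power_4: "(zeta8 powi \<sigma>) ^ 4 = - 1"
    and zeta8_powi_sign_power_2: "(zeta8 powi \<sigma>)\<^sup>2 = of_int \<sigma> * \<i>"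
    and zeta8_powi_sign_sum: "zeta8 powi \<sigma> + (zeta8 powi \<sigma>) ^ 3 = of_int \<sigma> * csqrt (- 2)"
proof -
  have "zeta8 * - (zeta8 ^ 3) = 1" using zeta8_power_4 by (simp add: eval_nat_numeral)
  then have inverse: "inverse zeta8 = - (zeta8 ^ 3)" by (rule inverse_unique)
  have "(zeta8 ^ 3) ^ 3 = (zeta8 ^ 4)\<^sup>2 * zeta8" by (simp add: eval_nat_numeral mult.assoc)
  then have "(zeta8 ^ 3) ^ 3 = zeta8" by (simp add: zeta8_power_4)
  then show "zeta8 powi \<sigma> + (zeta8 powi \<sigma>) ^ 3 = of_int \<sigma> * csqrt (- 2)"
    using assms by (auto simp: inverse csqrt_minus_2 simp del: power_mult)
  show "(zeta8 powi \<sigma>) ^ 4 = - 1" "(zeta8 powi \<sigma>)\<^sup>2 = of_int \<sigma> * \<i>"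
    using assms by (auto simp: zeta8_power_2 zeta8_power_4 power_inverse)
qed

lemma zeta8_powi_image_octants:
  assumes "\<sigma> \<in> {1, - 1 :: int}" and h_eq: "h = 2 * h' + (1 - \<sigma>) div 2"
  shows "(\<lambda>i. zeta8 powi i) ` {(h + i) mod 8 | i. i \<in> {0, 1, 2, 3}} =
    (\<lambda>j. zeta8 powi (2 * h' + 2 * (1 - \<sigma>)) * (zeta8 powi \<sigma>) powi j) ` {0, 1, 2, 3}"
proof -
  have "zeta8 \<noteq> 0" using zeta8_power_4 by auto
  then have mult_powi: "zeta8 powi (2 * h' + 2 * (1 - \<sigma>)) * (zeta8 powi \<sigma>) powi j =
      zeta8 powi (2 * h' + 2 * (1 - \<sigma>) + \<sigma> * j)" for j
    by (simp only: power_int_add power_int_mult simp_thms)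
  have "(\<lambda>i. zeta8 powi i) ` {(h + i) mod 8 | i. i \<in> {0, 1, 2, 3}} =
      (\<lambda>i. zeta8 powi ((h + i) mod 8)) ` {0, 1, 2, 3}" by blast
  also have "\<dots> = (\<lambda>i. zeta8 powi (h + i)) ` {0, 1, 2, 3}"
    by (intro image_cong refl) (simp add: eighth_root_powi_eq_iff[OF zeta8_power_4])
  also have "\<dots> = (\<lambda>j. zeta8 powi (2 * h' + 2 * (1 - \<sigma>) + \<sigma> * j)) ` {0, 1, 2, 3}"
    using assms(1) by (auto simp: h_eq add.commute)
  finally show ?thesis unfolding mult_powi .
qed

section \<open>The octic character\<close>

locale octic_character = quadratic_extension K for K :: "'a::{field,finite} set" +
  fixes \<omega> :: 'a and chi8 :: "'a \<Rightarrow> complex" and \<zeta> :: complex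
  assumes q_mod_8: "card K mod 8 = 3"
    and primitive: "primitive_element \<omega>"
    and mult_char: "mult_char UNIV chi8"
    and chi8_omega: "chi8 \<omega> = \<zeta>"
    and zeta_power_4: "\<zeta> ^ 4 = - 1"
begin

lemmas omega_nonzero = primitive_element_nonzero[OF primitive]
  and chi8_mult = mult_char_mult[OF mult_char]
  and chi8_nonzero = mult_char_nonzero[OF mult_char]
  and chi8_divide = mult_char_divide[OF mult_char]
  and chi8_power = mult_char_power[OF mult_char]

lemma chi8_omega_powi: "chi8 (\<omega> powi n) = \<zeta> powi n"
  by (simp add: mult_char_power_int[OF mult_char] omega_nonzero chi8_omega)

lemma zeta_power_8: "\<zeta> ^ 8 = 1"
proof -
  have "\<zeta> ^ 8 = (\<zeta> ^ 4)\<^sup>2" by (simp flip: power_mult)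
  then show ?thesis by (simp add: zeta_power_4)
qed

lemma chi8_power_8:
  assumes "x \<noteq> 0"
  shows "chi8 x ^ 8 = 1"
proof -
  obtain n where "x = \<omega> ^ n" using primitive assms by (rule primitive_element_powerE)
  then have "chi8 x ^ 8 = (\<zeta> ^ 8) ^ n"
    by (simp add: chi8_power omega_nonzero chi8_omega mult.commute flip: power_mult)
  then show ?thesis by (simp add: zeta_power_8)
qed

lemma chi8_frobenius:
  assumes "x \<noteq> 0"
  shows "chi8 (x ^ q) = chi8 x ^ 3"
proof -
  have "chi8 (x ^ q) = chi8 x ^ (8 * (q div 8) + 3)"
    using assms mult_div_mod_eq[of 8 q] by (simp add: chi8_power q_mod_8)
  then show ?thesis
    using assms by (simp add: power_add power_mult chi8_power_8)
qed

lemma omega_norm: "\<omega> ^ (q + 1) \<in> K - {0}" and chi8_omega_norm: "chi8 (\<omega> ^ (q + 1)) = - 1"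
proof -
  show "\<omega> ^ (q + 1) \<in> K - {0}" using norm_in_K[of \<omega>] omega_nonzero by simp
  have "chi8 (\<omega> ^ (q + 1)) = \<zeta> ^ 3 * \<zeta>"
    by (simp add: chi8_mult chi8_frobenius omega_nonzero chi8_omega)
  then show "chi8 (\<omega> ^ (q + 1)) = - 1"
    using zeta_power_4 by (simp add: eval_nat_numeral mult.assoc)
qed

lemma subfield_unit_norm_powerE:
  assumes "x \<in> K - {0}"
  obtains c :: nat where "x = (\<omega> ^ (q + 1)) ^ c"
proof -
  obtain n where x_eq: "x = \<omega> ^ n" using primitive assms by (auto elim: primitive_element_powerE)
  then have "\<omega> powi int n \<in> K" using assms by simp
  then have "int q + 1 dvd int n"
    by (simp only: primitive_element_powi_in_K_iff[OF primitive])
  then have "q + 1 dvd n" by (simp only: of_nat_add of_nat_1 flip: int_dvd_int_iff)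
  then obtain c where "n = (q + 1) * c" by (rule dvdE)
  then show ?thesis using that by (simp only: x_eq power_mult)
qed

lemma chi8_eq_quad_char:
  assumes "x \<in> K - {0}"
  shows "chi8 x = quad_char K x"
proof (cases "x \<in> nonzero_squares K")
  case True
  then obtain y where y_root: "y \<in> K" "y \<noteq> 0" "x = y\<^sup>2" by (auto simp: nonzero_squares_def)
  have "chi8 y ^ 3 = chi8 y" using chi8_frobenius[OF y_root(2)] y_root(1) by (simp add: mem_K_iff)
  then have "(chi8 y)\<^sup>2 = 1" using chi8_nonzero[OF y_root(2)] by (simp add: eval_nat_numeral)
  then show ?thesis using True assms y_root(2,3) by (simp add: quad_char_def chi8_power)
next
  case False
  obtain c where x_eq: "x = (\<omega> ^ (q + 1)) ^ c" using assms by (rule subfield_unit_norm_powerE)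
  have "odd c"
  proof
    assume "even c"
    then obtain d where "c = 2 * d" by (rule evenE)
    then have "x = ((\<omega> ^ (q + 1)) ^ d)\<^sup>2" unfolding x_eq by (simp only: power_mult mult.commute[of 2])
    moreover have "(\<omega> ^ (q + 1)) ^ d \<in> K - {0}"
      using omega_norm by (induction d) (simp_all add: one_in_K K_closed)
    ultimately show False using False by (auto simp: nonzero_squares_def)
  qed
  moreover have "chi8 x = chi8 (\<omega> ^ (q + 1)) ^ c"
    unfolding x_eq using omega_norm by (intro chi8_power) simp
  ultimately have "chi8 x = - 1" unfolding chi8_omega_norm by simp
  then show ?thesis using False assms by (simp add: quad_char_def)
qed

lemma eisenstein_sum_chi8:
  assumes "gauss_sum UNIV chi8 = gauss_sum K (quad_char K) * E"
  shows "eisenstein_sum chi8 = E"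
proof -
  have nontrivial: "chi8 (\<omega> ^ (q + 1)) \<noteq> 1" unfolding chi8_omega_norm by simp
  have "gauss_sum K chi8 = gauss_sum K (quad_char K)"
    unfolding gauss_sum_def by (intro sum.cong) (auto simp: chi8_eq_quad_char)
  moreover have "gauss_sum K chi8 \<noteq> 0"
    using mult_char_subset[OF mult_char] omega_norm nontrivial by (intro gauss_sum_nonzero) auto
  ultimately show ?thesis
    using gauss_sum_UNIV_eq[OF mult_char omega_norm nontrivial] assms by simp
qed

lemma chi8_sum_line:
  assumes A_notin_K: "A \<notin> K"
  shows "(\<Sum>x\<in>K. chi8 (1 + x * A)) = chi8 (A ^ q - A) / chi8 A ^ 3 * eisenstein_sum chi8"
proof -
  have "A \<noteq> 0" using A_notin_K zero_in_K by blast
  then show ?thesis by (simp add: sum_one_plus_mult[OF mult_char A_notin_K] chi8_frobenius)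
qed

lemma chi8_sum_line_twisted:
  assumes A_notin_K: "A \<notin> K" and s_in_K: "s \<in> K"
  shows "(\<Sum>x\<in>K. quad_char K (x - s) * chi8 (1 + x * A)) =
    chi8 (A ^ q - A) ^ 3 / chi8 (1 + s * A) ^ 3 * eisenstein_sum chi8 - chi8 A"
proof -
  have "(\<Sum>x\<in>K. quad_char K (x - s) * chi8 (1 + x * A)) =
      (\<Sum>x\<in>K - {s}. quad_char K (x - s) * chi8 (1 + x * A))"
    using s_in_K by (subst sum.remove[of _ s]) (auto simp: quad_char_def)
  also have "\<dots> = (\<Sum>x\<in>K - {s}. chi8 ((1 + x * A) / (x - s)))"
  proof (intro sum.cong refl)
    fix x assume "x \<in> K - {s}"
    then have x_units: "x \<in> K" "x - s \<in> K - {0}" using s_in_K K_closed(2) by auto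
    have "chi8 ((1 + x * A) / (x - s)) = chi8 (1 + x * A) / quad_char K (x - s)"
      using one_plus_mult_nonzero[OF A_notin_K x_units(1)] x_units(2)
      by (simp add: chi8_divide chi8_eq_quad_char)
    then show "quad_char K (x - s) * chi8 (1 + x * A) = chi8 ((1 + x * A) / (x - s))"
      using x_units(2) by (auto simp: quad_char_def)
  qed
  also have "\<dots> = chi8 (A - A ^ q) / chi8 ((1 + s * A) ^ q) * eisenstein_sum chi8 - chi8 A"
    by (rule sum_one_plus_mult_over_diff[OF mult_char A_notin_K s_in_K])
  also have "A - A ^ q = (A ^ q - A) ^ q"
    by (simp add: frobenius_diff frobenius_frobenius)
  also have "chi8 \<dots> = chi8 (A ^ q - A) ^ 3"
    using A_notin_K by (intro chi8_frobenius) (simp add: mem_K_iff)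
  also have "chi8 ((1 + s * A) ^ q) = chi8 (1 + s * A) ^ 3"
    by (rule chi8_frobenius[OF one_plus_mult_nonzero[OF A_notin_K s_in_K]])
  finally show ?thesis .
qed

lemma chi8_even_power_sum_line:
  assumes A_notin_K: "A \<notin> K" and j_range: "j \<in> {1, 2, 3}"
  shows "(\<Sum>x\<in>K. chi8 (1 + x * A) ^ (2 * j)) = - (chi8 A ^ (2 * j))"
proof (rule sum_one_plus_mult_trivial_on_K[where \<kappa> = "\<lambda>x. chi8 x ^ (2 * j)" and w = \<omega>])
  show "mult_char UNIV (\<lambda>x. chi8 x ^ (2 * j))"
    by (simp add: mult_char_def chi8_nonzero chi8_mult power_mult_distrib)
  show "chi8 k ^ (2 * j) = 1" if "k \<in> K - {0}" for k
    unfolding chi8_eq_quad_char[OF that] using that by (simp add: quad_char_def)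
  show "chi8 \<omega> ^ (2 * j) \<noteq> 1"
    using j_range eighth_root_powi_eq_1_iff[OF zeta_power_4, of "2 * int j"] by (auto simp: chi8_omega)
qed (use omega_nonzero A_notin_K in auto)

lemma mem_cyc_class_8_iff:
  assumes "x \<noteq> 0"
  shows "x \<in> cyc_class 8 \<omega> i \<longleftrightarrow> chi8 x = \<zeta> powi i"
proof
  have class_element: "\<omega> powi i * (\<omega> ^ 8) powi k = \<omega> powi (i + 8 * k)" for k
    using omega_nonzero by (simp add: power_int_add power_int_mult)
  show "chi8 x = \<zeta> powi i" if "x \<in> cyc_class 8 \<omega> i"
    using that
    by (auto simp: cyc_class_def class_element chi8_omega_powi eighth_root_powi_eq_iff[OF zeta_power_4]
        cong_def)
  assume "chi8 x = \<zeta> powi i"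
  moreover obtain n where x_eq: "x = \<omega> ^ n" using primitive assms by (rule primitive_element_powerE)
  ultimately have "\<zeta> powi int n = \<zeta> powi i" using chi8_omega_powi[of "int n"] by simp
  then have "[int n = i] (mod 8)" by (simp only: eighth_root_powi_eq_iff[OF zeta_power_4])
  then obtain k where "int n = i + 8 * k" using cong_iff_lin[of i "int n" 8] cong_sym by blast
  then have "x = \<omega> powi (i + 8 * k)" by (simp add: x_eq flip: power_int_of_nat)
  then show "x \<in> cyc_class 8 \<omega> i" unfolding cyc_class_def class_element[symmetric] by blast
qed

end

section \<open>Intersection numbers\<close>

lemma int_card_Collect:
  assumes "finite K"
  shows "int (card {x \<in> K. P x}) = (\<Sum>x\<in>K. of_bool (P x))"
  using assms by (simp add: of_bool_def sum.If_cases Int_def)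

definition int_quad_char :: "'a::field set \<Rightarrow> 'a \<Rightarrow> int" where
  "int_quad_char K x = (if x = 0 then 0 else if x \<in> nonzero_squares K then 1 else - 1)"

lemma of_int_int_quad_char: "of_int (int_quad_char K x) = quad_char K x"
  by (simp add: quad_char_def int_quad_char_def)

text \<open>Writing the values of the octic character on the line \<open>1 + K A\<close> as \<open>c * \<rho> ^ n\<close>, where \<open>\<rho>\<close> is \<open>\<zeta>\<close> or
  its inverse according to the sign \<open>\<epsilon>\<delta>\<close> of the theorem, makes the relations between them independent
  of \<open>\<epsilon>\<close>, \<open>\<delta>\<close> and \<open>h'\<close>.\<close>

locale octic_line = octic_character K \<omega> chi8 \<zeta>
  for K :: "'a::{field,finite} set" and \<omega> chi8 \<zeta> +
  fixes A :: 'a and c \<rho> :: complex and m \<epsilon> :: int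
  assumes A_notin_K: "A \<notin> K"
    and c_power_4: "c ^ 4 = 1"
    and rho_power_4: "\<rho> ^ 4 = - 1"
    and eps_square: "\<epsilon>\<^sup>2 = 1"
    and q_eq: "int (card K) = 4 * m\<^sup>2 + 4 * m + 3"
    and chi8_A: "chi8 A = c * \<rho> ^ 5"
    and chi8_A_diff: "chi8 (A ^ card K - A) = - (of_int \<epsilon> * \<rho>\<^sup>2)"
    and eisenstein_chi8: "eisenstein_sum chi8 = of_int \<epsilon> * (of_int (2 * m + 1) + \<rho> + \<rho> ^ 3)"
begin

definition line_index :: "'a \<Rightarrow> int" where
  "line_index x = (SOME n. 0 \<le> n \<and> n < 8 \<and> chi8 (1 + x * A) = c * \<rho> powi n)"

definition line_weight :: "(int \<Rightarrow> 'b::ring_1) \<Rightarrow> int \<Rightarrow> 'b" where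
  "line_weight \<phi> n = of_int (2 * m + 1) * \<phi> (n + 2) + \<phi> (n + 3) + \<phi> (n + 5)"

lemma c_nonzero: "c \<noteq> 0" and rho_nonzero: "\<rho> \<noteq> 0"
  using c_power_4 rho_power_4 by auto

lemma
  assumes "x \<in> K"
  shows line_index_nonneg: "0 \<le> line_index x" and line_index_less_8: "line_index x < 8"
    and chi8_line_index: "chi8 (1 + x * A) = c * \<rho> powi line_index x"
proof -
  have "c ^ 8 = (c ^ 4)\<^sup>2" by (simp flip: power_mult)
  then have "(chi8 (1 + x * A) / c) ^ 8 = 1"
    using chi8_power_8[OF one_plus_mult_nonzero[OF A_notin_K assms]]
    by (simp add: power_divide c_power_4)
  with rho_power_4 obtain n where "0 \<le> n" "n < 8" "chi8 (1 + x * A) / c = \<rho> powi n"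
    by (rule eighth_power_eq_1_powiE)
  then have "\<exists>n. 0 \<le> n \<and> n < 8 \<and> chi8 (1 + x * A) = c * \<rho> powi n"
    using c_nonzero by (auto simp: field_simps)
  from someI_ex[OF this, folded line_index_def]
  show "0 \<le> line_index x" "line_index x < 8" "chi8 (1 + x * A) = c * \<rho> powi line_index x"
    by blast+
qed

lemma rho_powi_add_8_mult: "\<rho> powi (n + 8 * k) = \<rho> powi n"
  by (rule antiperiodic4_add_8_mult[OF antiperiodic4_eighth_root_powi[OF rho_power_4]])

lemma rho_powi_add_4: "\<rho> powi (n + 4) = - (\<rho> powi n)"
  using antiperiodic4_eighth_root_powi[OF rho_power_4] by (simp add: antiperiodic4_def)

lemma inverse_cube: "1 / (c * \<rho> powi n) ^ 3 = c * \<rho> powi (5 * n)"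
proof -
  have "(c * \<rho> powi (5 * n)) * (c * \<rho> powi n) ^ 3 = c ^ 4 * (\<rho> powi (5 * n) * (\<rho> powi n) ^ 3)"
    by (simp add: power_mult_distrib eval_nat_numeral mult_ac)
  also have "\<rho> powi (5 * n) * (\<rho> powi n) ^ 3 = \<rho> powi (5 * n + n * int 3)"
    using rho_nonzero by (simp only: power_int_power' power_int_add simp_thms)
  also have "5 * n + n * int 3 = 0 + 8 * n" by simp
  also have "\<rho> powi (0 + 8 * n) = 1" by (simp only: rho_powi_add_8_mult power_int_0_right)
  finally show ?thesis
    using c_nonzero rho_nonzero by (simp add: c_power_4 field_simps)
qed

lemma rho_powi_mult_eisenstein:
  "\<rho> powi (n + 2) * (of_int (2 * m + 1) + \<rho> + \<rho> ^ 3) = line_weight (\<lambda>n. \<rho> powi n) n"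
  using rho_nonzero by (simp add: line_weight_def power_int_add algebra_simps eval_nat_numeral)

lemma sum_rho_powi_line_index: "(\<Sum>x\<in>K. \<rho> powi line_index x) = line_weight (\<lambda>n. \<rho> powi n) 5"
proof -
  let ?W = "of_int (2 * m + 1) + \<rho> + \<rho> ^ 3"
  have "c * (\<Sum>x\<in>K. \<rho> powi line_index x) = (\<Sum>x\<in>K. chi8 (1 + x * A))"
    by (simp add: chi8_line_index sum_distrib_left)
  also have "\<dots> = - (of_int (\<epsilon>\<^sup>2) * \<rho>\<^sup>2) * (1 / (c * \<rho> powi 5) ^ 3) * ?W"
    unfolding chi8_sum_line[OF A_notin_K] chi8_A_diff chi8_A eisenstein_chi8
    by (simp add: power2_eq_square)
  also have "\<dots> = - (c * \<rho> powi (23 + 4) * ?W)"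
    unfolding inverse_cube eps_square using rho_nonzero by (simp flip: power_add)
  also have "\<dots> = c * (\<rho> powi (7 + 8 * 2) * ?W)"
    unfolding rho_powi_add_4 by simp
  also have "\<dots> = c * line_weight (\<lambda>n. \<rho> powi n) 5"
    unfolding rho_powi_add_8_mult using rho_powi_mult_eisenstein[of 5] by simp
  finally show ?thesis using c_nonzero by simp
qed

lemma sum_rho_powi_line_index_twisted:
  assumes s_in_K: "s \<in> K"
  shows "(\<Sum>x\<in>K. quad_char K (x - s) * \<rho> powi line_index x) =
    line_weight (\<lambda>n. \<rho> powi n) (5 * line_index s) - \<rho> powi 5"
proof -
  let ?W = "of_int (2 * m + 1) + \<rho> + \<rho> ^ 3" and ?n = "line_index s"
  have "c * (\<Sum>x\<in>K. quad_char K (x - s) * \<rho> powi line_index x) =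
      (\<Sum>x\<in>K. quad_char K (x - s) * chi8 (1 + x * A))"
    by (simp add: chi8_line_index sum_distrib_left mult_ac)
  also have "\<dots> = - (of_int ((\<epsilon>\<^sup>2)\<^sup>2) * (\<rho>\<^sup>2) ^ 3) * (1 / (c * \<rho> powi ?n) ^ 3) * ?W - c * \<rho> powi 5"
    unfolding chi8_sum_line_twisted[OF A_notin_K s_in_K] chi8_A_diff chi8_A eisenstein_chi8
      chi8_line_index[OF s_in_K]
    by (simp add: power_mult_distrib eval_nat_numeral)
  also have "- (of_int ((\<epsilon>\<^sup>2)\<^sup>2) * (\<rho>\<^sup>2) ^ 3) = \<rho>\<^sup>2"
    unfolding eps_square using rho_power_4 power_add[of \<rho> 4 2] by (simp flip: power_mult)
  also have "\<rho>\<^sup>2 * (1 / (c * \<rho> powi ?n) ^ 3) * ?W - c * \<rho> powi 5 =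
      c * (\<rho> powi (5 * ?n + 2) * ?W) - c * \<rho> powi 5"
    unfolding inverse_cube using rho_nonzero by (simp add: power_int_add)
  also have "\<dots> = c * (line_weight (\<lambda>n. \<rho> powi n) (5 * ?n) - \<rho> powi 5)"
    unfolding rho_powi_mult_eisenstein by (simp add: right_diff_distrib)
  finally show ?thesis using c_nonzero by (simp only: mult_left_cancel not_False_eq_True)
qed

lemma rho_relation_antiperiodic:
  fixes \<phi> :: "int \<Rightarrow> int"
  assumes "antiperiodic4 \<phi>"
    and relation: "(\<Sum>x\<in>K. of_int (g x) * \<rho> powi i x) =
      line_weight (\<lambda>n. \<rho> powi n) n - of_int a * \<rho> powi k"
  shows "(\<Sum>x\<in>K. g x * \<phi> (i x)) = line_weight \<phi> n - a * \<phi> k"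
proof -
  have "antiperiodic4 (\<lambda>n. of_int (\<phi> n) :: rat)" using assms(1) by (simp add: antiperiodic4_def)
  with rho_power_4 obtain \<Phi> :: "complex \<Rightarrow> rat"
    where additive: "Modules.additive \<Phi>" and \<Phi>: "\<And>n. \<Phi> (\<rho> powi n) = of_int (\<phi> n)"
    by (rule eighth_root_functional) blast
  interpret \<Phi>: Modules.additive \<Phi> by (rule additive)
  note transfer = \<Phi>.add \<Phi>.diff \<Phi>.sum additive_of_int_mult[OF additive] \<Phi>
  have "of_int (\<Sum>x\<in>K. g x * \<phi> (i x)) = \<Phi> (\<Sum>x\<in>K. of_int (g x) * \<rho> powi i x)"
    unfolding transfer by simp
  also have "\<dots> = of_int (line_weight \<phi> n - a * \<phi> k)"
    unfolding relation line_weight_def transfer by simp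
  finally show ?thesis by (simp only: of_int_eq_iff)
qed

lemma sum_line_index:
  fixes \<phi> :: "int \<Rightarrow> int"
  assumes "antiperiodic4 \<phi>"
  shows "(\<Sum>x\<in>K. \<phi> (line_index x)) = line_weight \<phi> 5"
  using rho_relation_antiperiodic[OF assms, of "\<lambda>_. 1" line_index 5 0] sum_rho_powi_line_index
  by simp

lemma sum_line_index_twisted:
  fixes \<phi> :: "int \<Rightarrow> int"
  assumes "antiperiodic4 \<phi>" "s \<in> K"
  shows "(\<Sum>x\<in>K. int_quad_char K (x - s) * \<phi> (line_index x)) =
    line_weight \<phi> (5 * line_index s) - \<phi> 5"
  using rho_relation_antiperiodic[OF assms(1), of "\<lambda>x. int_quad_char K (x - s)" line_index
      "5 * line_index s" 1 5] sum_rho_powi_line_index_twisted[OF assms(2)]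
  by (simp add: of_int_int_quad_char)

lemma sum_rho_even_powi_line_index:
  assumes j_range: "j \<in> {1, 2, 3}"
  shows "(\<Sum>x\<in>K. \<rho> powi (2 * int j * line_index x)) = - (\<rho> powi (2 * int j * 5))"
proof -
  have even_power: "(c * \<rho> powi n) ^ (2 * j) = c ^ (2 * j) * \<rho> powi (2 * int j * n)" for n
    by (simp add: power_mult_distrib power_int_power' mult_ac)
  have "c ^ (2 * j) * (\<Sum>x\<in>K. \<rho> powi (2 * int j * line_index x)) =
      (\<Sum>x\<in>K. chi8 (1 + x * A) ^ (2 * j))"
    unfolding sum_distrib_left even_power[symmetric] by (simp add: chi8_line_index)
  also have "\<dots> = - ((c * \<rho> powi 5) ^ (2 * j))"
    unfolding chi8_even_power_sum_line[OF A_notin_K j_range] chi8_A by simp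
  also have "\<dots> = c ^ (2 * j) * - (\<rho> powi (2 * int j * 5))" unfolding even_power by simp
  finally show ?thesis
    using c_nonzero by (simp only: mult_left_cancel power_not_zero not_False_eq_True)
qed

lemma card_line_index_mod_4:
  "int (card {x \<in> K. [line_index x = k] (mod 4)}) = m\<^sup>2 + m + 1 - of_bool ([5 = k] (mod 4))"
proof -
  have orthogonality: "4 * of_bool ([n = k] (mod 4)) =
      (\<Sum>j<4. \<rho> powi (2 * int j * n) * \<rho> powi (- (2 * int j * k)))" for n
    unfolding cong_iff_dvd_diff eighth_root_even_power_sum[OF rho_power_4, symmetric]
    using rho_nonzero by (intro sum.cong) (simp_all add: right_diff_distrib flip: power_int_add)
  define S where "S j = (\<Sum>x\<in>K. \<rho> powi (2 * int j * line_index x))" for j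
  define T where "T j = \<rho> powi (2 * int j * 5)" for j
  have "of_int (4 * int (card {x \<in> K. [line_index x = k] (mod 4)})) =
      (\<Sum>x\<in>K. 4 * of_bool ([line_index x = k] (mod 4)) :: complex)"
    unfolding int_card_Collect[OF finite] by (simp add: sum_distrib_left)
  also have "\<dots> = (\<Sum>j<4. S j * \<rho> powi (- (2 * int j * k)))"
    unfolding orthogonality S_def by (subst sum.swap) (simp add: sum_distrib_right)
  also have "\<dots> = (\<Sum>j<4. (if j = 0 then of_nat q + 1 else 0) - T j * \<rho> powi (- (2 * int j * k)))"
  proof (intro sum.cong refl)
    fix j :: nat assume "j \<in> {..<4}"
    then consider "j = 0" | "j \<in> {1, 2, 3}" by fastforce
    then show "S j * \<rho> powi (- (2 * int j * k)) =
        (if j = 0 then of_nat q + 1 else 0) - T j * \<rho> powi (- (2 * int j * k))"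
      by cases (auto simp: S_def T_def sum_rho_even_powi_line_index)
  qed
  also have "\<dots> = of_nat q + 1 - 4 * of_bool ([5 = k] (mod 4))"
    unfolding orthogonality T_def by (simp add: sum_subtractf)
  also have "\<dots> = of_int (int q + 1 - 4 * of_bool ([5 = k] (mod 4)))"
    by simp
  finally have "4 * int (card {x \<in> K. [line_index x = k] (mod 4)}) =
      int q + 1 - 4 * of_bool ([5 = k] (mod 4))"
    by (simp only: of_int_eq_iff)
  then show ?thesis unfolding q_eq by simp
qed

lemma card_line_index:
  assumes k_range: "0 \<le> k" "k < 8"
  shows "2 * int (card {x \<in> K. line_index x = k}) =
    m\<^sup>2 + m + 1 - of_bool ([5 = k] (mod 4)) + line_weight (residue_sign8 k) 5"
proof -
  have "2 * of_bool (line_index x = k) =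
      of_bool ([line_index x = k] (mod 4)) + residue_sign8 k (line_index x)" if "x \<in> K" for x
    using line_index_nonneg[OF that] line_index_less_8[OF that] k_range
    by (simp add: residue_sign8_def cong_def)
  then have "2 * int (card {x \<in> K. line_index x = k}) =
      (\<Sum>x\<in>K. of_bool ([line_index x = k] (mod 4)) + residue_sign8 k (line_index x))"
    unfolding int_card_Collect[OF finite] sum_distrib_left by (intro sum.cong refl) blast
  then show ?thesis
    unfolding sum.distrib int_card_Collect[OF finite, symmetric] card_line_index_mod_4
      sum_line_index[OF antiperiodic4_residue_sign8] .
qed

definition D :: "'a set" where "D = {x \<in> K. line_index x < 4}"

lemma card_D: "int (card D) = 2 * m\<^sup>2 + m + 2"
proof -
  have "sign8 (line_index x) = 2 * of_bool (line_index x < 4) - 1" if "x \<in> K" for x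
    using line_index_nonneg[OF that] line_index_less_8[OF that] by (simp add: sign8_def)
  then have "(\<Sum>x\<in>K. sign8 (line_index x)) = 2 * int (card D) - int q"
    by (simp add: D_def int_card_Collect sum_subtractf sum_distrib_left)
  then show ?thesis
    unfolding sum_line_index[OF antiperiodic4_sign8] by (simp add: line_weight_def sign8_def q_eq)
qed

lemma sum_int_quad_char:
  assumes s_in_K: "s \<in> K"
  shows "(\<Sum>x\<in>K. int_quad_char K (x - s)) = 0"
proof -
  have nontrivial: "chi8 (\<omega> ^ (q + 1)) \<noteq> 1" unfolding chi8_omega_norm by simp
  have "of_int (\<Sum>x\<in>K. int_quad_char K x) = (\<Sum>x\<in>K. quad_char K x)"
    by (simp add: of_int_int_quad_char)
  also have "\<dots> = (\<Sum>x\<in>K - {0}. chi8 x)"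
    using zero_in_K by (subst sum.remove[of _ 0]) (auto simp: chi8_eq_quad_char quad_char_def)
  also have "\<dots> = 0"
    using mult_char_subset[OF mult_char] omega_norm nontrivial
    by (intro mult_char_sum_eq_0[OF subfield]) auto
  finally have "(\<Sum>x\<in>K. int_quad_char K x) = 0" by (simp only: of_int_eq_0_iff)
  then show ?thesis
    using sum.reindex_bij_betw[OF bij_betw_add_K[OF K_uminus[OF s_in_K]], of "int_quad_char K"]
    by simp
qed

lemma card_D_Int_translate:
  assumes s_in_K: "s \<in> K"
  shows "4 * int (card (D \<inter> (\<lambda>x. x + s) ` (nonzero_squares K \<union> {0}))) =
    2 * int (card D) + (\<Sum>x\<in>K. int_quad_char K (x - s) * sign8 (line_index x))
    + 2 * of_bool (line_index s < 4)"
proof -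
  let ?Q = "nonzero_squares K \<union> {0}"
  have zero_nonsquare: "0 \<notin> nonzero_squares K" by (auto simp: nonzero_squares_def)
  have "x \<in> (\<lambda>x. x + s) ` ?Q \<longleftrightarrow> x - s \<in> ?Q" for x
    by (force simp: image_iff)
  then have "D \<inter> (\<lambda>x. x + s) ` ?Q = {x \<in> K. line_index x < 4 \<and> x - s \<in> ?Q}"
    by (auto simp: D_def)
  then have "4 * int (card (D \<inter> (\<lambda>x. x + s) ` ?Q)) =
      (\<Sum>x\<in>K. 4 * of_bool (line_index x < 4 \<and> x - s \<in> ?Q))"
    by (simp only: int_card_Collect[OF finite] sum_distrib_left)
  also have "\<dots> = (\<Sum>x\<in>K. 2 * of_bool (line_index x < 4)
      + int_quad_char K (x - s) * sign8 (line_index x) + int_quad_char K (x - s)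
      + (if x = s then 2 * of_bool (line_index s < 4) else 0))"
    using zero_nonsquare line_index_nonneg line_index_less_8
    by (intro sum.cong refl) (auto simp: int_quad_char_def sign8_def)
  also have "\<dots> = 2 * int (card D) + (\<Sum>x\<in>K. int_quad_char K (x - s) * sign8 (line_index x))
      + 2 * of_bool (line_index s < 4)"
    using s_in_K
    by (simp add: sum.distrib sum_int_quad_char D_def int_card_Collect flip: sum_distrib_left)
  finally show ?thesis .
qed

definition translate_card :: "'a \<Rightarrow> int" where
  "translate_card s = int (card (D \<inter> (\<lambda>x. x + s) ` (nonzero_squares K \<union> {0})))"

lemma translate_card_eq:
  assumes s_in_K: "s \<in> K"
  shows "translate_card s =
    (if line_index s \<in> {2, 4, 7} then m\<^sup>2 + 1
     else if line_index s = 1 then m\<^sup>2 + 2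
     else if line_index s = 5 then m\<^sup>2 + m + 1
     else m\<^sup>2 + m + 2)"
proof -
  have "4 * translate_card s = 4 * m\<^sup>2 + 2 * m + 5
      + line_weight sign8 (5 * line_index s) + 2 * of_bool (line_index s < 4)"
    unfolding translate_card_def card_D_Int_translate[OF s_in_K] card_D
      sum_line_index_twisted[OF antiperiodic4_sign8 s_in_K]
    by (simp add: sign8_def)
  moreover have "line_index s \<in> {0, 1, 2, 3, 4, 5, 6, 7}"
    using line_index_nonneg[OF s_in_K] line_index_less_8[OF s_in_K] by simp linarith
  ultimately show ?thesis by (auto simp: line_weight_def sign8_def)
qed

lemma line_index_attained:
  assumes "m \<noteq> - 1"
  shows "\<exists>s\<in>K. line_index s = 0" "\<exists>s\<in>K. line_index s = 2"
    "m \<noteq> 0 \<Longrightarrow> \<exists>s\<in>K. line_index s = 1" "m \<noteq> 0 \<Longrightarrow> \<exists>s\<in>K. line_index s = 5"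
proof -
  have factor: "m\<^sup>2 + m = m * (m + 1)" by (simp add: power2_eq_square algebra_simps)
  have positive: "m\<^sup>2 + m > 0" if "m \<noteq> 0"
    unfolding factor zero_less_mult_iff using that assms by linarith
  then have nonneg: "m\<^sup>2 + m \<ge> 0" by (cases "m = 0") auto
  have attained: "\<exists>s\<in>K. line_index s = k" if "int (card {x \<in> K. line_index x = k}) > 0" for k
    using that by (force simp: card_gt_0_iff)
  show "\<exists>s\<in>K. line_index s = 0" "\<exists>s\<in>K. line_index s = 2"
    using card_line_index[of 0] card_line_index[of 2] nonneg
    by (intro attained; simp add: line_weight_def residue_sign8_def cong_def)+
  show "\<exists>s\<in>K. line_index s = 1" "\<exists>s\<in>K. line_index s = 5" if "m \<noteq> 0"
    using card_line_index[of 1] card_line_index[of 5] positive[OF that]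
    by (intro attained; simp add: line_weight_def residue_sign8_def cong_def)+
qed

lemma range_translate_card:
  assumes "m \<noteq> - 1"
  shows "translate_card ` K = {m\<^sup>2 + 1, m\<^sup>2 + 2, m\<^sup>2 + m + 1, m\<^sup>2 + m + 2}"
proof
  show "translate_card ` K \<subseteq> {m\<^sup>2 + 1, m\<^sup>2 + 2, m\<^sup>2 + m + 1, m\<^sup>2 + m + 2}"
    using translate_card_eq by auto
  have even_index_values: "m\<^sup>2 + 1 \<in> translate_card ` K" "m\<^sup>2 + m + 2 \<in> translate_card ` K"
    using line_index_attained(1,2)[OF assms] translate_card_eq by (force simp: image_iff)+
  moreover have "m\<^sup>2 + 2 \<in> translate_card ` K \<and> m\<^sup>2 + m + 1 \<in> translate_card ` K"
  proof (cases "m = 0")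
    case True
    then show ?thesis using even_index_values by simp
  next
    case False
    then show ?thesis
      using line_index_attained(3,4)[OF assms] translate_card_eq by (force simp: image_iff)
  qed
  ultimately show "{m\<^sup>2 + 1, m\<^sup>2 + 2, m\<^sup>2 + m + 1, m\<^sup>2 + m + 2} \<subseteq> translate_card ` K"
    by simp
qed

lemma D_set_eq_D:
  assumes A_eq: "A = \<omega> powi l"
    and octants: "(\<lambda>i. \<zeta> powi i) ` H = (\<lambda>j. c * \<rho> powi j) ` {0, 1, 2, 3}"
  shows "D_set K \<omega> l H = D"
proof -
  have "1 + x * A \<in> (\<Union>i\<in>H. cyc_class 8 \<omega> i) \<longleftrightarrow> line_index x < 4" if x_in_K: "x \<in> K" for x
  proof -
    have "1 + x * A \<in> (\<Union>i\<in>H. cyc_class 8 \<omega> i) \<longleftrightarrow> chi8 (1 + x * A) \<in> (\<lambda>i. \<zeta> powi i) ` H"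
      using mem_cyc_class_8_iff[OF one_plus_mult_nonzero[OF A_notin_K x_in_K]] by auto
    also have "\<dots> \<longleftrightarrow> (\<exists>j\<in>{0, 1, 2, 3}. \<rho> powi line_index x = \<rho> powi j)"
      unfolding octants chi8_line_index[OF x_in_K] using c_nonzero by auto
    also have "\<dots> \<longleftrightarrow> line_index x < 4"
      using line_index_nonneg[OF x_in_K] line_index_less_8[OF x_in_K]
      by (auto simp: eighth_root_powi_eq_iff[OF rho_power_4] cong_def)
    finally show ?thesis .
  qed
  then show ?thesis unfolding D_set_def D_def A_eq[symmetric] by blast
qed

end

lemma octic_line_intro:
  fixes m \<epsilon> \<delta> h' l :: int and K :: "'a::{field,finite} set"
  assumes "octic_character K \<omega> chi8 zeta8"
    and q_eq: "int (card K) = 4 * m\<^sup>2 + 4 * m + 3"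
    and eps_sign: "\<epsilon> \<in> {1, - 1}" and delta_sign: "\<delta> \<in> {1, - 1}"
    and gauss: "gauss_sum UNIV chi8 =
      gauss_sum K (quad_char K) * (of_int (\<epsilon> * (2 * m + 1)) + of_int \<delta> * csqrt (- 2))"
    and l_not_dvd: "\<not> int (card K) + 1 dvd l"
    and chi8_l: "chi8 (\<omega> powi l) = zeta8 powi (2 - 5 * \<epsilon> * \<delta> - 6 * h')"
    and chi8_diff: "chi8 (\<omega> powi (l * int (card K)) - \<omega> powi l) = - (\<i> powi \<delta>)"
  shows "octic_line K \<omega> chi8 zeta8 (\<omega> powi l) (zeta8 powi (2 * h' + 2 * (1 - \<epsilon> * \<delta>)))
    (zeta8 powi (\<epsilon> * \<delta>)) m \<epsilon>"
proof -
  interpret octic_character K \<omega> chi8 zeta8 by fact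
  let ?\<sigma> = "\<epsilon> * \<delta>"
  let ?c = "zeta8 powi (2 * h' + 2 * (1 - ?\<sigma>))" and ?\<rho> = "zeta8 powi ?\<sigma>"
  have "?\<sigma> \<in> {1, - 1}" using eps_sign delta_sign by auto
  note rho_power_4 = zeta8_powi_sign_power_4[OF this]
    and rho_power_2 = zeta8_powi_sign_power_2[OF this]
    and rho_sum = zeta8_powi_sign_sum[OF this]
  have zeta8_nonzero: "zeta8 \<noteq> 0" using zeta8_power_4 by auto
  show ?thesis
  proof unfold_locales
    show "\<omega> powi l \<notin> K" using l_not_dvd by (simp add: primitive_element_powi_in_K_iff[OF primitive])
    have "?c ^ 4 = zeta8 powi (8 * (h' + 1 - ?\<sigma>))"
      by (simp add: power_int_power' algebra_simps)
    then show "?c ^ 4 = 1" by (simp add: eighth_root_powi_eq_1_iff[OF zeta8_power_4])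
    have "?c * ?\<rho> ^ 5 = zeta8 powi (2 * h' + 2 * (1 - ?\<sigma>) + ?\<sigma> * int 5)"
      using zeta8_nonzero by (simp only: power_int_power' power_int_add simp_thms)
    also have "\<dots> = zeta8 powi (2 - 5 * \<epsilon> * \<delta> - 6 * h')"
      unfolding eighth_root_powi_eq_iff[OF zeta8_power_4] cong_iff_dvd_diff
      by (simp add: algebra_simps)
    finally show "chi8 (\<omega> powi l) = ?c * ?\<rho> ^ 5" using chi8_l by simp
    have "\<i> powi \<delta> = of_int \<delta> * \<i>" using delta_sign by auto
    then show "chi8 ((\<omega> powi l) ^ q - \<omega> powi l) = - (of_int \<epsilon> * ?\<rho>\<^sup>2)"
      unfolding rho_power_2 using chi8_diff eps_sign by (auto simp: power_int_mult)
    show "eisenstein_sum chi8 = of_int \<epsilon> * (of_int (2 * m + 1) + ?\<rho> + ?\<rho> ^ 3)"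
      unfolding eisenstein_sum_chi8[OF gauss] add.assoc rho_sum using eps_sign by auto
    show "\<epsilon>\<^sup>2 = 1" using eps_sign by auto
  qed (use q_eq rho_power_4 in simp_all)
qed

theorem theorem4p2:
  fixes m :: int and q :: nat
    and K :: "'a::{field,finite} set" and \<omega> :: 'a
    and chi8 :: "'a \<Rightarrow> complex"
    and \<epsilon> \<delta> h' h l :: int and H :: "int set"
  assumes "int q = 4 * m\<^sup>2 + 4 * m + 3" and "primepow q"
    and "CARD('a) = q\<^sup>2"
    and "is_subfield K" and "card K = q"
    and "primitive_element \<omega>"
    and "mult_char UNIV chi8" and "chi8 \<omega> = exp (2 * of_real pi * \<i> / 8)"
    and "\<epsilon> \<in> {1, - 1}" and "\<delta> \<in> {1, - 1}"
    and "gauss_sum UNIV chi8 =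
           gauss_sum K (quad_char K) * (of_int (\<epsilon> * (2 * m + 1)) + of_int \<delta> * csqrt (- 2))"
    and "h' \<in> {0, 1, 2, 3}" and "h = 2 * h' + (1 - \<epsilon> * \<delta>) div 2"
    and "\<not> (int q + 1) dvd l"
    and "chi8 (\<omega> powi l) = exp (2 * of_real pi * \<i> / 8) powi (2 - 5 * \<epsilon> * \<delta> - 6 * h')"
    and "chi8 (\<omega> powi (l * int q) - \<omega> powi l) = - (\<i> powi \<delta>)"
    and "H = {(h + i) mod 8 | i. i \<in> {0, 1, 2, 3}}"
  shows "int (card (D_set K \<omega> l H)) = 2 * m\<^sup>2 + m + 2 \<and>
    (m \<noteq> - 1 \<longrightarrow>
      {int (card (D_set K \<omega> l H \<inter> (\<lambda>x. x + s) ` (nonzero_squares K \<union> {0}))) | s. s \<in> K}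
        = {m\<^sup>2 + 1, m\<^sup>2 + 2, m\<^sup>2 + m + 1, m\<^sup>2 + m + 2})"
proof -
  have "even (m\<^sup>2 + m)" by (simp add: power2_eq_square)
  then obtain j where "m\<^sup>2 + m = 2 * j" by (rule evenE)
  then have "int q = 8 * j + 3" using assms(1) by simp
  then have "q mod 8 = 3" by presburger
  moreover have "quadratic_extension K"
    using assms(2-5) by (intro quadratic_extension_intro) simp_all
  ultimately interpret octic_character K \<omega> chi8 zeta8
    using assms(5-8) zeta8_power_4
    by (simp add: octic_character_def octic_character_axioms_def zeta8_def)
  interpret octic_line K \<omega> chi8 zeta8 "\<omega> powi l" "zeta8 powi (2 * h' + 2 * (1 - \<epsilon> * \<delta>))"
    "zeta8 powi (\<epsilon> * \<delta>)" m \<epsilon>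
    using assms(1,5,9-11,14-16) octic_character_axioms
    by (intro octic_line_intro) (simp_all add: zeta8_def)
  have "\<epsilon> * \<delta> \<in> {1, - 1}" using assms(9,10) by auto
  then have "D_set K \<omega> l H = D"
    using zeta8_powi_image_octants assms(13,17) by (intro D_set_eq_D) simp_all
  moreover have "{int (card (D \<inter> (\<lambda>x. x + s) ` (nonzero_squares K \<union> {0}))) | s. s \<in> K} =
      translate_card ` K"
    unfolding translate_card_def by blast
  ultimately show ?thesis using card_D range_translate_card by simp
qed

end
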